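(* Let $\mathbb{T}$ be the field of LE-transseries in a formal variable $\mathbf{x}$ and let $\mathfrak{M}^{LE}\subseteq \mathbb{T}^{>0}$ be its multiplicative group of transmonomials, ordered by the order of $\mathbb{T}$. Then the ordered group $(\mathfrak{M}^{LE},\cdot,1,<)$ is isomorphic to the ordered additive group $(\mathbb{T},+,0,<)$.
   Context: $\mathbb{T}$ denotes the ordered exponential field of LE-transseries of van den Dries–Macintyre–Marker; it is a subfield of the Hahn field $\mathbb{R}((\mathfrak{M}^{LE}))$ of formal series with real coefficients and reverse-well-ordered support in the ordered abelian group $\mathfrak{M}^{LE}$ of LE-monomials (transmonomials). Equivalently, $\mathfrak{M}^{LE}$ is the value group of $\mathbb{T}$ for its natural (archimedean) valuation. *)

theory Defs
  imports Complex_Main "HOL-Library.Countable_Set_Type"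
begin

definition supp :: "('a \<Rightarrow> real) \<Rightarrow> 'a set" where
  "supp f = {m. f m \<noteq> 0}"

text \<open>For a strict linear order \<open>R\<close>: \<open>S\<close> is reverse well-ordered, i.e. every nonempty
  subset of \<open>S\<close> has a largest element. \<open>hahn R S\<close> is the underlying set of the Hahn field
  \<open>\<real>((S))\<close>, a series being identified with its coefficient function, and \<open>series_less R\<close>
  compares two series by their coefficients at the largest monomial at which they differ.\<close>

definition rwo :: "('a \<Rightarrow> 'a \<Rightarrow> bool) \<Rightarrow> 'a set \<Rightarrow> bool" where
  "rwo R S \<longleftrightarrow> (\<forall>A\<subseteq>S. A \<noteq> {} \<longrightarrow> (\<exists>m\<in>A. \<forall>a\<in>A. a = m \<or> R a m))"

definition hahn :: "('a \<Rightarrow> 'a \<Rightarrow> bool) \<Rightarrow> 'a set \<Rightarrow> ('a \<Rightarrow> real) set" where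
  "hahn R S = {f. supp f \<subseteq> S \<and> rwo R (supp f)}"

definition series_less :: "('a \<Rightarrow> 'a \<Rightarrow> bool) \<Rightarrow> ('a \<Rightarrow> real) \<Rightarrow> ('a \<Rightarrow> real) \<Rightarrow> bool" where
  "series_less R f g \<longleftrightarrow> (\<exists>m. f m < g m \<and> (\<forall>m'. f m' \<noteq> g m' \<longrightarrow> m' = m \<or> R m' m))"

lemma rwoE:
  assumes "rwo R S" "A \<subseteq> S" "A \<noteq> {}"
  shows "\<exists>m. m \<in> A \<and> (\<forall>a. a \<in> A \<longrightarrow> a = m \<or> R a m)"
  using assms(1)[unfolded rwo_def, rule_format, OF assms(2,3)] by auto

lemma rwo_subset: "rwo R S \<Longrightarrow> T \<subseteq> S \<Longrightarrow> rwo R T"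
  unfolding rwo_def by (meson subset_trans)

lemma hahn_mono: "S \<subseteq> T \<Longrightarrow> hahn R S \<subseteq> hahn R T"
  unfolding hahn_def by (simp add: Collect_mono_iff) (meson subset_trans)

definition slin :: "('a \<Rightarrow> 'a \<Rightarrow> bool) \<Rightarrow> 'a set \<Rightarrow> bool" where
  "slin R S \<longleftrightarrow> irreflp_on S R \<and> transp_on S R \<and> totalp_on S R"

lemma slin_irrefl: "slin R S \<Longrightarrow> a \<in> S \<Longrightarrow> \<not> R a a"
  unfolding slin_def irreflp_on_def by blast

lemma slin_trans: "slin R S \<Longrightarrow> a \<in> S \<Longrightarrow> b \<in> S \<Longrightarrow> c \<in> S \<Longrightarrow> R a b \<Longrightarrow> R b c \<Longrightarrow> R a c"
  unfolding slin_def transp_on_def by blast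

lemma slin_total: "slin R S \<Longrightarrow> a \<in> S \<Longrightarrow> b \<in> S \<Longrightarrow> a \<noteq> b \<Longrightarrow> R a b \<or> R b a"
  unfolding slin_def totalp_on_def by blast

lemma slin_asym: "slin R S \<Longrightarrow> a \<in> S \<Longrightarrow> b \<in> S \<Longrightarrow> R a b \<Longrightarrow> \<not> R b a"
  by (meson slin_irrefl slin_trans)

lemma slin_subset: "slin R S \<Longrightarrow> T \<subseteq> S \<Longrightarrow> slin R T"
  unfolding slin_def irreflp_on_def transp_on_def totalp_on_def by blast

lemma slin_conv: "slin R S \<Longrightarrow> slin R\<inverse>\<inverse> S"
  unfolding slin_def irreflp_on_def transp_on_def totalp_on_def conversep_iff by meson

lemma rwo_Un:
  assumes S: "slin R S" and "A \<subseteq> S" "B \<subseteq> S" "rwo R A" "rwo R B"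
  shows "rwo R (A \<union> B)"
  unfolding rwo_def
proof (intro allI impI)
  fix C assume C: "C \<subseteq> A \<union> B" "C \<noteq> {}"
  show "\<exists>m\<in>C. \<forall>a\<in>C. a = m \<or> R a m"
  proof (cases "C \<inter> A = {} \<or> C \<inter> B = {}")
    case True
    then have "C \<subseteq> A \<or> C \<subseteq> B" using C by blast
    then show ?thesis using assms(4,5) C(2) unfolding rwo_def by blast
  next
    case False
    obtain a where a: "a \<in> C \<inter> A" "\<And>x. x \<in> C \<inter> A \<Longrightarrow> x = a \<or> R x a"
      using False rwoE[OF assms(4), of "C \<inter> A"] by auto
    obtain b where b: "b \<in> C \<inter> B" "\<And>x. x \<in> C \<inter> B \<Longrightarrow> x = b \<or> R x b"
      using False rwoE[OF assms(5), of "C \<inter> B"] by auto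
    have ab: "a \<in> S" "b \<in> S" and CS: "C \<subseteq> S" using a b C assms(2,3) by auto
    consider "a = b" | "R a b" | "R b a" using slin_total[OF S ab] by blast
    then show ?thesis
    proof cases
      case 1 then show ?thesis using a b C by blast
    next
      case 2
      have "x = b \<or> R x b" if "x \<in> C" for x
        using that a(2)[of x] b(2)[of x] C(1) 2 slin_trans[OF S _ ab, of x] CS by blast
      then show ?thesis using b by blast
    next
      case 3
      have "x = a \<or> R x a" if "x \<in> C" for x
        using that a(2)[of x] b(2)[of x] C(1) 3 slin_trans[OF S _ ab(2,1), of x] CS by blast
      then show ?thesis using a by blast
    qed
  qed
qed

lemma rwo_image:
  assumes "rwo R S" "\<And>a b. a \<in> S \<Longrightarrow> b \<in> S \<Longrightarrow> R a b \<Longrightarrow> f a = f b \<or> Q (f a) (f b)"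
  shows "rwo Q (f ` S)"
  unfolding rwo_def
proof (intro allI impI)
  fix A assume A: "A \<subseteq> f ` S" "A \<noteq> {}"
  define B where "B = {s\<in>S. f s \<in> A}"
  have B: "B \<subseteq> S" unfolding B_def by auto
  obtain a where a: "a \<in> A" using A(2) by auto
  obtain s where s: "s \<in> S" "a = f s" using subsetD[OF A(1) a] by (rule imageE)
  have B': "B \<noteq> {}" using a s unfolding B_def by auto
  from rwoE[OF assms(1) B B'] obtain m where m: "m \<in> B" "\<And>a. a \<in> B \<Longrightarrow> a = m \<or> R a m"
    by auto
  have "x = f m \<or> Q x (f m)" if xA: "x \<in> A" for x
  proof -
    obtain s where "s \<in> S" "x = f s" using subsetD[OF A(1) xA] by (rule imageE)
    then show ?thesis using m(2)[of s] m(1) xA assms(2)[of s m] by (auto simp: B_def)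
  qed
  moreover have "f m \<in> A" using m(1) by (simp add: B_def)
  ultimately show "\<exists>m\<in>A. \<forall>a\<in>A. a = m \<or> Q a m" by blast
qed

lemma supp_diff: "{m. f m \<noteq> g m} \<subseteq> supp f \<union> supp g"
  unfolding supp_def by auto

lemma hahn_supp_in: "f \<in> hahn R S \<Longrightarrow> g \<in> hahn R S \<Longrightarrow> f m \<noteq> g m \<Longrightarrow> m \<in> S"
  using supp_diff[of f g] unfolding hahn_def by blast

lemma hahn_diff:
  assumes "slin R S" "f \<in> hahn R S" "g \<in> hahn R S" "f \<noteq> g"
  obtains m where "m \<in> S" "f m \<noteq> g m" "\<And>m'. f m' \<noteq> g m' \<Longrightarrow> m' = m \<or> R m' m"
proof -
  have "rwo R (supp f \<union> supp g)"
    using assms unfolding hahn_def by (intro rwo_Un[OF assms(1)]) auto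
  moreover have "{m. f m \<noteq> g m} \<noteq> {}" using assms(4) by (auto simp: fun_eq_iff)
  ultimately have "\<exists>m. m \<in> {m. f m \<noteq> g m} \<and> (\<forall>a. a \<in> {m. f m \<noteq> g m} \<longrightarrow> a = m \<or> R a m)"
    by (intro rwoE[OF _ supp_diff])
  then obtain m where m: "f m \<noteq> g m" "\<And>a. f a \<noteq> g a \<Longrightarrow> a = m \<or> R a m"
    by auto
  moreover have "m \<in> S" using hahn_supp_in[OF assms(2,3) m(1)] .
  ultimately show thesis by (intro that)
qed

lemma slin_hahn:
  assumes "slin R S"
  shows "slin (series_less R) (hahn R S)"
  unfolding slin_def
proof (intro conjI)
  show "irreflp_on (hahn R S) (series_less R)"
    unfolding irreflp_on_def series_less_def by auto
  show "totalp_on (hahn R S) (series_less R)"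
    unfolding totalp_on_def
  proof (intro ballI impI)
    fix f g assume fg: "f \<in> hahn R S" "g \<in> hahn R S" "f \<noteq> g"
    obtain m where m: "f m \<noteq> g m" "\<And>m'. f m' \<noteq> g m' \<Longrightarrow> m' = m \<or> R m' m"
      using hahn_diff[OF assms fg] by metis
    have "f m < g m \<or> g m < f m" using m(1) by auto
    then show "series_less R f g \<or> series_less R g f"
      unfolding series_less_def using m(2) by metis
  qed
  show "transp_on (hahn R S) (series_less R)"
    unfolding transp_on_def
  proof (intro ballI impI)
    fix f g h assume H: "f \<in> hahn R S" "g \<in> hahn R S" "h \<in> hahn R S"
    assume "series_less R f g" "series_less R g h"
    then obtain m n where m: "f m < g m" "\<And>x. f x \<noteq> g x \<Longrightarrow> x = m \<or> R x m"
      and n: "g n < h n" "\<And>x. g x \<noteq> h x \<Longrightarrow> x = n \<or> R x n"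
      unfolding series_less_def by blast
    have S: "m \<in> S" "n \<in> S" using hahn_supp_in[OF H(1,2), of m] hahn_supp_in[OF H(2,3), of n] m n by auto
    have xS: "x \<in> S" if "f x \<noteq> h x" for x using hahn_supp_in[OF H(1,3) that] .
    have or: "f x \<noteq> g x \<or> g x \<noteq> h x" if "f x \<noteq> h x" for x using that by auto
    consider "m = n" | "R m n" | "R n m" using slin_total[OF assms S] by blast
    then show "series_less R f h"
    proof cases
      case 1
      have "x = m \<or> R x m" if "f x \<noteq> h x" for x
        using or[OF that] m(2) n(2) 1 by blast
      moreover have "f m < h m" using m(1) n(1) 1 by simp
      ultimately show ?thesis unfolding series_less_def by blast
    next
      case 2
      then have "f n = g n" using m(2) slin_irrefl[OF assms S(1)] slin_asym[OF assms S] by blast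
      moreover have "x = n \<or> R x n" if "f x \<noteq> h x" for x
        using or[OF that] m(2) n(2) 2 slin_trans[OF assms xS[OF that] S] by blast
      ultimately show ?thesis unfolding series_less_def using n by (intro exI[of _ n]) auto
    next
      case 3
      then have "g m = h m" using n(2) slin_irrefl[OF assms S(1)] slin_asym[OF assms S(2,1)] by blast
      moreover have "x = m \<or> R x m" if "f x \<noteq> h x" for x
        using or[OF that] m(2) n(2) 3 slin_trans[OF assms xS[OF that] S(2,1)] by blast
      ultimately show ?thesis unfolding series_less_def using m by (intro exI[of _ m]) auto
    qed
  qed
qed

text \<open>\<open>short R S\<close>: neither \<open>\<omega>\<^sub>1\<close> nor its reverse embeds into \<open>S\<close>. This property passes from the
  monomials to the Hahn field over them, which is why the countable sets in the
  datatype below impose no restriction on the supports of the series.\<close>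

definition short :: "('a \<Rightarrow> 'a \<Rightarrow> bool) \<Rightarrow> 'a set \<Rightarrow> bool" where
  "short R S \<longleftrightarrow> (\<forall>A\<subseteq>S. rwo R A \<or> rwo R\<inverse>\<inverse> A \<longrightarrow> countable A)"

lemma wo_real_countable:
  fixes W :: "real set"
  assumes "rwo (>) W"
  shows "countable W"
proof -
  have "\<exists>q. w < of_rat q \<and> (\<forall>v\<in>W. w < v \<longrightarrow> of_rat q < v)" for w
  proof (cases "{v\<in>W. w < v} = {}")
    case False
    have "{v\<in>W. w < v} \<subseteq> W" by blast
    from rwoE[OF assms this False] obtain s
      where s: "s \<in> W" "w < s" "\<And>v. v \<in> W \<Longrightarrow> w < v \<Longrightarrow> v = s \<or> v > s"
      by auto
    obtain q where "w < of_rat q" "of_rat q < s" using s(2) of_rat_dense[of w s] by auto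
    then show ?thesis using s(3) by (intro exI[of _ q]) (auto dest: s(3))
  next
    case True
    obtain q where "w < of_rat q" using of_rat_dense[of w "w + 1"] by auto
    then show ?thesis using True by blast
  qed
  then obtain q :: "real \<Rightarrow> rat" where
    q: "\<And>w. w < of_rat (q w)" "\<And>w v. v \<in> W \<Longrightarrow> w < v \<Longrightarrow> of_rat (q w) < v"
    by metis
  have "inj_on q W"
  proof (rule inj_onI)
    fix v w assume "v \<in> W" "w \<in> W" "q v = q w"
    then show "v = w" using q(1)[of v] q(1)[of w] q(2)[of v w] q(2)[of w v] by (cases v w rule: linorder_cases) auto
  qed
  then show ?thesis using countable_image_inj_on[of q W] by auto
qed

lemma shortD: "short R S \<Longrightarrow> A \<subseteq> S \<Longrightarrow> rwo R A \<or> rwo R\<inverse>\<inverse> A \<Longrightarrow> countable A"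
  unfolding short_def by meson

lemma series_less_top:
  assumes "slin R S" "f \<in> hahn R S" "g \<in> hahn R S" "series_less R f g"
    and "f m \<noteq> g m" "\<And>x. f x \<noteq> g x \<Longrightarrow> x = m \<or> R x m"
  shows "f m < g m"
proof -
  obtain k where k: "f k < g k" "\<And>x. f x \<noteq> g x \<Longrightarrow> x = k \<or> R x k"
    using assms(4) unfolding series_less_def by auto
  have "k \<in> S" "m \<in> S" using hahn_supp_in[OF assms(2,3)] k(1) assms(5) by auto
  then have "k = m" using k(2)[OF assms(5)] assms(6)[of k] k(1) slin_asym[OF assms(1), of k m] by auto
  then show ?thesis using k(1) by simp
qed

lemma eventually_const:
  assumes lin: "\<And>u v. u \<in> V \<Longrightarrow> v \<in> V \<Longrightarrow> u \<noteq> v \<Longrightarrow> L u v \<or> L v u"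
    and seg: "\<And>v. v \<in> V \<Longrightarrow> countable {u\<in>V. L u v}"
    and Z: "Z \<subseteq> V" "uncountable Z" "countable (p ` Z)"
    and mono: "\<And>u v. u \<in> Z \<Longrightarrow> v \<in> Z \<Longrightarrow> L u v \<Longrightarrow> p u = p v \<or> Q (p u) (p v)"
    and asym: "\<And>u v. u \<in> Z \<Longrightarrow> v \<in> Z \<Longrightarrow> Q (p u) (p v) \<Longrightarrow> \<not> Q (p v) (p u)"
  shows "\<exists>c. countable {w\<in>Z. p w \<noteq> c}"
proof -
  have "Z = (\<Union>c\<in>p ` Z. {w\<in>Z. p w = c})" by auto
  then obtain c where c: "uncountable {w\<in>Z. p w = c}"
    using Z(2,3) countable_UN[of "p ` Z" "\<lambda>c. {w\<in>Z. p w = c}"] by auto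
  then obtain w1 where w1: "w1 \<in> Z" "p w1 = c" by (metis (mono_tags, lifting) countable_empty empty_Collect_eq)
  have "{w\<in>Z. p w \<noteq> c} \<subseteq> {w\<in>V. L w w1}"
  proof
    fix w assume "w \<in> {w\<in>Z. p w \<noteq> c}"
    then have w: "w \<in> Z" "p w \<noteq> c" by auto
    have "L w w1"
    proof (rule ccontr)
      assume "\<not> L w w1"
      then have 1: "L w1 w" using lin[of w w1] w w1 Z(1) by auto
      have "countable (insert w {u\<in>V. L u w})" using seg[of w] w(1) Z(1) by auto
      then have "\<not> {w\<in>Z. p w = c} \<subseteq> insert w {u\<in>V. L u w}" using c countable_subset by blast
      then obtain w2 where w2: "w2 \<in> Z" "p w2 = c" "w2 \<noteq> w" "\<not> L w2 w" using Z(1) by auto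
      then have 2: "L w w2" using lin[of w w2] w(1) Z(1) by auto
      have "Q (p w1) (p w)" using mono[OF w1(1) w(1) 1] w w1 by auto
      moreover have "Q (p w) (p w1)" using mono[OF w(1) w2(1) 2] w w1 w2 by auto
      ultimately show False using asym[OF w1(1) w(1)] by auto
    qed
    then show "w \<in> {w\<in>V. L w w1}" using w(1) Z(1) by auto
  qed
  then show ?thesis using countable_subset seg[of w1] w1(1) Z(1) by (metis subsetD)
qed

lemma omega1_segment:
  assumes lin: "slin L W" and wo: "rwo L\<inverse>\<inverse> W" and "uncountable W"
  shows "\<exists>V\<subseteq>W. uncountable V \<and> (\<forall>v\<in>V. countable {u\<in>V. L u v})"
proof (cases "\<exists>x\<in>W. uncountable {u\<in>W. L u x}")
  case True
  define B where "B = {x\<in>W. uncountable {u\<in>W. L u x}}"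
  have "B \<subseteq> W" "B \<noteq> {}" using True by (auto simp: B_def)
  from rwoE[OF wo this] obtain x where x: "x \<in> B" "\<And>a. a \<in> B \<Longrightarrow> a = x \<or> L x a" by auto
  have xW: "x \<in> W" using x(1) by (simp add: B_def)
  have "countable {u\<in>{u\<in>W. L u x}. L u v}" if "v \<in> {u\<in>W. L u x}" for v
  proof -
    have v: "v \<in> W" "L v x" using that by auto
    have "v \<notin> B" using x(2)[of v] v slin_asym[OF lin v(1) xW] slin_irrefl[OF lin xW] by auto
    then have "countable {u\<in>W. L u v}" using v(1) by (simp add: B_def)
    then show ?thesis by (rule countable_subset[rotated]) auto
  qed
  moreover have "uncountable {u\<in>W. L u x}" using x(1) by (simp add: B_def)
  ultimately show ?thesis by (intro exI[of _ "{u\<in>W. L u x}"]) auto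
next
  case False
  then show ?thesis using assms(3) by (intro exI[of _ W]) auto
qed

lemma hahn_wo_countable:
  assumes S: "slin R S" and sh: "short R S"
    and W: "W \<subseteq> hahn R S" "rwo (series_less R)\<inverse>\<inverse> W"
  shows "countable W"
proof (rule ccontr)
  assume unc: "uncountable W"
  let ?L = "series_less R"
  have HL: "slin ?L (hahn R S)" by (rule slin_hahn[OF S])
  obtain V where V: "V \<subseteq> W" "uncountable V" and seg: "\<And>v. v \<in> V \<Longrightarrow> countable {u\<in>V. ?L u v}"
    using omega1_segment[OF slin_subset[OF HL W(1)] W(2) unc] by auto
  have VH: "w \<in> hahn R S" if "w \<in> V" for w using that V(1) W(1) by auto
  have lin: "?L u v \<or> ?L v u" if "u \<in> V" "v \<in> V" "u \<noteq> v" for u v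
    using slin_total[OF HL VH VH] that by auto
  have VS: "x \<in> S" if "w \<in> V" "w x \<noteq> 0" for w x
    using VH[OF that(1)] that(2) unfolding hahn_def supp_def by auto
  define agree where "agree g w h \<longleftrightarrow> (\<forall>x\<in>S. x = g \<or> R g x \<longrightarrow> w x = h x)" for g and w h :: "'a \<Rightarrow> real"
  define D where "D = {g\<in>S. \<exists>h. countable {w\<in>V. \<not> agree g w h}}"
  define H where "H g = (SOME h. countable {w\<in>V. \<not> agree g w h})" for g
  have H: "countable {w\<in>V. \<not> agree g w (H g)}" if "g \<in> D" for g
  proof -
    have "\<exists>h. countable {w\<in>V. \<not> agree g w h}" using that by (simp add: D_def)
    then show ?thesis unfolding H_def by (rule someI_ex)
  qed
  define hb where "hb = (\<lambda>x. if x \<in> D then H x x else 0)"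
  have DS: "D \<subseteq> S" by (auto simp: D_def)
  have ex2: "\<exists>w\<in>V. w \<notin> A \<and> w \<notin> B" if "countable A" "countable B" for A B
  proof (rule ccontr)
    assume "\<not> ?thesis"
    then have "V \<subseteq> A \<union> B" by auto
    then have "countable V" by (rule countable_subset) (use that in auto)
    then show False using V(2) by simp
  qed
  have up: "x \<in> D \<and> H x x = H g x" if gx: "g \<in> D" "x \<in> S" "x = g \<or> R g x" for g x
  proof -
    have g: "g \<in> S" using gx(1) DS by auto
    have ag: "agree x w (H g)" if "agree g w (H g)" for w
      unfolding agree_def
    proof (intro ballI impI)
      fix y assume "y \<in> S" "y = x \<or> R x y"
      then have "y = g \<or> R g y" using gx(3) slin_trans[OF S g gx(2), of y] by auto
      then show "w y = H g y" using that \<open>y \<in> S\<close> unfolding agree_def by auto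
    qed
    have "{w\<in>V. \<not> agree x w (H g)} \<subseteq> {w\<in>V. \<not> agree g w (H g)}" using ag by auto
    then have c: "countable {w\<in>V. \<not> agree x w (H g)}" by (rule countable_subset) (rule H[OF gx(1)])
    then have x: "x \<in> D" using gx(2) unfolding D_def by auto
    obtain w where "w \<in> V" "agree x w (H g)" "agree x w (H x)" using ex2[OF c H[OF x]] by auto
    then have "H x x = H g x" using gx(2) unfolding agree_def by auto
    then show ?thesis using x by simp
  qed
  have hbD: "countable {w\<in>V. \<not> agree g w hb}" if g: "g \<in> D" for g
  proof -
    have "agree g w hb" if "agree g w (H g)" for w
      using that up[OF g] unfolding agree_def hb_def by auto
    then have "{w\<in>V. \<not> agree g w hb} \<subseteq> {w\<in>V. \<not> agree g w (H g)}" by auto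
    then show ?thesis by (rule countable_subset) (rule H[OF g])
  qed
  have hbH: "hb \<in> hahn R S"
  proof -
    have sD: "supp hb \<subseteq> D" unfolding supp_def hb_def by auto
    have "\<exists>m\<in>A. \<forall>a\<in>A. a = m \<or> R a m" if A: "A \<subseteq> supp hb" "A \<noteq> {}" for A
    proof -
      obtain g where g: "g \<in> A" using A(2) by auto
      have AS: "a \<in> S" if "a \<in> A" for a using that A(1) sD DS by auto
      have gD: "g \<in> D" using g A(1) sD by auto
      obtain w where w: "w \<in> V" "agree g w hb" using ex2[OF hbD[OF gD] countable_empty] by auto
      define A' where "A' = {x\<in>A. x = g \<or> R g x}"
      have "A' \<noteq> {}" using g by (auto simp: A'_def)
      moreover have "A' \<subseteq> supp w"
      proof
        fix x assume x: "x \<in> A'"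
        then have "w x = hb x" using w(2) AS unfolding agree_def A'_def by auto
        then show "x \<in> supp w" using x A(1) unfolding A'_def supp_def by auto
      qed
      moreover have "rwo R (supp w)" using VH[OF w(1)] unfolding hahn_def by auto
      ultimately obtain m where m: "m \<in> A'" "\<And>a. a \<in> A' \<Longrightarrow> a = m \<or> R a m"
        using rwoE[of R "supp w" A'] by auto
      have "a = m \<or> R a m" if a: "a \<in> A" for a
      proof (cases "a \<in> A'")
        case True then show ?thesis using m(2) by auto
      next
        case False
        then have "R a g" using a slin_total[OF S AS[OF a] AS[OF g]] by (auto simp: A'_def)
        moreover have "m = g \<or> R g m" "m \<in> A" using m(1) by (auto simp: A'_def)
        ultimately show ?thesis using slin_trans[OF S AS[OF a] AS[OF g] AS] by auto
      qed
      moreover have "m \<in> A" using m(1) by (auto simp: A'_def)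
      ultimately show ?thesis by blast
    qed
    then show ?thesis using sD DS unfolding hahn_def rwo_def by auto
  qed
  have "\<exists>k. w \<in> V \<longrightarrow> w \<noteq> hb \<longrightarrow> k \<in> S \<and> w k \<noteq> hb k \<and> (\<forall>x. w x \<noteq> hb x \<longrightarrow> x = k \<or> R x k)" for w
  proof (cases "w \<in> V \<and> w \<noteq> hb")
    case True
    then obtain m where "m \<in> S" "w m \<noteq> hb m" "\<And>m'. w m' \<noteq> hb m' \<Longrightarrow> m' = m \<or> R m' m"
      using hahn_diff[OF S VH hbH, of w] by metis
    then show ?thesis by auto
  qed auto
  then obtain k where k0: "\<forall>w. w \<in> V \<longrightarrow> w \<noteq> hb \<longrightarrow> k w \<in> S \<and> w (k w) \<noteq> hb (k w) \<and> (\<forall>x. w x \<noteq> hb x \<longrightarrow> x = k w \<or> R x (k w))"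
    by metis
  have k: "k w \<in> S" "w (k w) \<noteq> hb (k w)" "\<And>x. w x \<noteq> hb x \<Longrightarrow> x = k w \<or> R x (k w)"
    if "w \<in> V" "w \<noteq> hb" for w using k0 that by auto
  have above: "w x = hb x" if "w \<in> V" "w \<noteq> hb" "R (k w) x" "x \<in> S" for w x
  proof (rule ccontr)
    assume "w x \<noteq> hb x"
    then have "x = k w \<or> R x (k w)" using k(3)[OF that(1,2)] by auto
    then show False
      using that(3) slin_irrefl[OF S that(4)] slin_asym[OF S k(1)[OF that(1,2)] that(4)] by auto
  qed
  have bad: False if "u \<in> V" "v \<in> V" "?L u v" "x \<in> S" "v x < u x" "\<And>y. v y \<noteq> u y \<Longrightarrow> y = x \<or> R y x" for u v x
  proof -
    have "?L v u" unfolding series_less_def using that(5,6) by auto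
    then show False using slin_asym[OF HL VH VH] that(1,2,3) by auto
  qed
  have "\<exists>Z Q. Z \<subseteq> V \<and> hb \<notin> Z \<and> countable (V - Z) \<and> (Q = R \<or> Q = R\<inverse>\<inverse>) \<and>
      (\<forall>u\<in>Z. \<forall>v\<in>Z. ?L u v \<longrightarrow> k u = k v \<or> Q (k u) (k v))"
  proof (cases "\<exists>v\<in>V. ?L hb v")
    case True
    then obtain v where v: "v \<in> V" "?L hb v" by auto
    let ?Z = "{w\<in>V. ?L hb w}"
    have nhb: "hb \<notin> ?Z" using slin_irrefl[OF HL hbH] by auto
    have "V - ?Z \<subseteq> insert hb {u\<in>V. ?L u v}"
    proof
      fix u assume u: "u \<in> V - ?Z"
      then have "u = hb \<or> ?L u hb" using slin_total[OF HL VH hbH, of u] by auto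
      then show "u \<in> insert hb {u\<in>V. ?L u v}"
        using u v slin_trans[OF HL VH hbH VH, of u v] by auto
    qed
    then have c: "countable (V - ?Z)" by (rule countable_subset) (use seg[OF v(1)] in auto)
    have "k u = k w \<or> R (k u) (k w)" if uw: "u \<in> ?Z" "w \<in> ?Z" "?L u w" for u w
    proof (rule ccontr)
      assume n: "\<not> ?thesis"
      have u: "u \<in> V" "u \<noteq> hb" "?L hb u" and w: "w \<in> V" "w \<noteq> hb" using uw nhb by auto
      have r: "R (k w) (k u)" using n slin_total[OF S k(1)[OF u(1,2)] k(1)[OF w]] by auto
      have "w (k u) = hb (k u)" using above[OF w r k(1)[OF u(1,2)]] .
      moreover have "hb (k u) < u (k u)"
        using series_less_top[OF S hbH VH[OF u(1)] u(3), of "k u"] k(2,3)[OF u(1,2)] by metis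
      moreover have "y = k u \<or> R y (k u)" if "w y \<noteq> u y" for y
      proof (cases "u y = hb y")
        case True
        then have wy: "w y \<noteq> hb y" using that by auto
        then have "y \<in> S" using hahn_supp_in[OF VH[OF w(1)] hbH] by auto
        then show ?thesis using k(3)[OF w wy] r slin_trans[OF S _ k(1)[OF w] k(1)[OF u(1,2)], of y] by auto
      qed (use k(3)[OF u(1,2)] in auto)
      ultimately show False using bad[OF u(1) w(1) uw(3) k(1)[OF u(1,2)]] by auto
    qed
    then show ?thesis using nhb c by (intro exI[of _ ?Z] exI[of _ R]) auto
  next
    case False
    let ?Z = "{w\<in>V. ?L w hb}"
    have nhb: "hb \<notin> ?Z" using slin_irrefl[OF HL hbH] by auto
    have "V - ?Z \<subseteq> {hb}" using False slin_total[OF HL VH hbH] by auto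
    then have c: "countable (V - ?Z)" by (rule countable_subset) auto
    have "k u = k w \<or> R (k w) (k u)" if uw: "u \<in> ?Z" "w \<in> ?Z" "?L u w" for u w
    proof (rule ccontr)
      assume n: "\<not> ?thesis"
      have u: "u \<in> V" "u \<noteq> hb" and w: "w \<in> V" "w \<noteq> hb" "?L w hb" using uw nhb by auto
      have r: "R (k u) (k w)" using n slin_total[OF S k(1)[OF u] k(1)[OF w(1,2)]] by auto
      have "u (k w) = hb (k w)" using above[OF u r k(1)[OF w(1,2)]] .
      moreover have "w (k w) < hb (k w)"
        using series_less_top[OF S VH[OF w(1)] hbH w(3), of "k w"] k(2,3)[OF w(1,2)] by metis
      moreover have "y = k w \<or> R y (k w)" if "w y \<noteq> u y" for y
      proof (cases "w y = hb y")
        case True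
        then have wy: "u y \<noteq> hb y" using that by auto
        then have "y \<in> S" using hahn_supp_in[OF VH[OF u(1)] hbH] by auto
        then show ?thesis using k(3)[OF u wy] r slin_trans[OF S _ k(1)[OF u] k(1)[OF w(1,2)], of y] by auto
      qed (use k(3)[OF w(1,2)] in auto)
      ultimately show False using bad[OF u(1) w(1) uw(3) k(1)[OF w(1,2)]] by auto
    qed
    then show ?thesis using nhb c by (intro exI[of _ ?Z] exI[of _ "R\<inverse>\<inverse>"]) auto
  qed
  then obtain Z Q where Z: "Z \<subseteq> V" "hb \<notin> Z" "countable (V - Z)" and Q: "Q = R \<or> Q = R\<inverse>\<inverse>"
    and km0: "\<forall>u\<in>Z. \<forall>v\<in>Z. ?L u v \<longrightarrow> k u = k v \<or> Q (k u) (k v)" by (elim exE conjE)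
  have km: "k u = k v \<or> Q (k u) (k v)" if "u \<in> Z" "v \<in> Z" "?L u v" for u v using km0 that by auto
  have ZV: "w \<in> V" "w \<noteq> hb" if "w \<in> Z" for w using that Z by auto
  have kS: "k w \<in> S" if "w \<in> Z" for w using k(1) ZV that by auto
  have uncZ: "uncountable Z"
  proof
    assume "countable Z"
    then have "countable (Z \<union> (V - Z))" using Z(3) by (rule countable_Un)
    moreover have "V \<subseteq> Z \<union> (V - Z)" by auto
    ultimately show False using V(2) countable_subset by blast
  qed
  have rZ: "rwo ?L\<inverse>\<inverse> Y" if "Y \<subseteq> Z" for Y using rwo_subset[OF W(2)] that Z(1) V(1) by auto
  have "rwo Q\<inverse>\<inverse> (k ` Z)"
  proof (rule rwo_image[OF rZ[OF order_refl]])
    fix a b assume "a \<in> Z" "b \<in> Z" "?L\<inverse>\<inverse> a b"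
    then show "k a = k b \<or> Q\<inverse>\<inverse> (k a) (k b)" using km[of b a] by auto
  qed
  then have "countable (k ` Z)" by (intro shortD[OF sh]) (use Q kS in auto)
  moreover have Qlin: "slin Q S" using S slin_conv[OF S] Q by auto
  ultimately have "\<exists>c0. countable {w\<in>Z. k w \<noteq> c0}"
    by (intro eventually_const[of V ?L Z k Q])
      (use lin seg Z(1) uncZ km slin_asym[OF Qlin kS kS] in auto)
  then obtain c0 where c0: "countable {w\<in>Z. k w \<noteq> c0}" ..
  define Z1 where "Z1 = {w\<in>Z. k w = c0}"
  have uncZ1: "uncountable Z1"
  proof
    assume "countable Z1"
    then have "countable (Z1 \<union> {w\<in>Z. k w \<noteq> c0})" using c0 by (rule countable_Un)
    moreover have "Z \<subseteq> Z1 \<union> {w\<in>Z. k w \<noteq> c0}" by (auto simp: Z1_def)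
    ultimately show False using uncZ countable_subset by blast
  qed
  have Z1: "w \<in> V" "w \<noteq> hb" "k w = c0" if "w \<in> Z1" for w using that ZV by (auto simp: Z1_def)
  have c0S: "c0 \<in> S" using uncZ1 kS unfolding Z1_def by (metis (mono_tags, lifting) countable_empty empty_Collect_eq)
  have m1: "u c0 = v c0 \<or> u c0 < v c0" if uv: "u \<in> Z1" "v \<in> Z1" "?L u v" for u v
  proof (rule ccontr)
    assume "\<not> ?thesis"
    then have "v c0 < u c0" by auto
    moreover have "y = c0 \<or> R y c0" if "v y \<noteq> u y" for y
      using k(3)[OF Z1(1,2)[OF uv(1)], of y] k(3)[OF Z1(1,2)[OF uv(2)], of y] that
        Z1(3)[OF uv(1)] Z1(3)[OF uv(2)] by (cases "u y = hb y") auto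
    ultimately show False using bad[OF Z1(1)[OF uv(1)] Z1(1)[OF uv(2)] uv(3) c0S] by auto
  qed
  have "rwo (>) ((\<lambda>w. w c0) ` Z1)"
  proof (rule rwo_image[OF rZ])
    fix a b assume "a \<in> Z1" "b \<in> Z1" "?L\<inverse>\<inverse> a b"
    then show "a c0 = b c0 \<or> a c0 > b c0" using m1[of b a] by auto
  qed (auto simp: Z1_def)
  then have "countable ((\<lambda>w. w c0) ` Z1)" by (rule wo_real_countable)
  moreover have "Z1 \<subseteq> V" using Z1 by auto
  ultimately have "\<exists>c. countable {w\<in>Z1. w c0 \<noteq> c}"
    by (intro eventually_const[of V ?L Z1 "\<lambda>w. w c0" "(<)"]) (use lin seg uncZ1 m1 in auto)
  then obtain c where c: "countable {w\<in>Z1. w c0 \<noteq> c}" ..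
  define h' where "h' = hb(c0 := c)"
  have "{w\<in>V. \<not> agree c0 w h'} \<subseteq> (V - Z) \<union> {w\<in>Z. k w \<noteq> c0} \<union> {w\<in>Z1. w c0 \<noteq> c}" (is "_ \<subseteq> ?X")
  proof
    fix w assume "w \<in> {w\<in>V. \<not> agree c0 w h'}"
    then have w: "w \<in> V" "\<not> agree c0 w h'" by auto
    show "w \<in> ?X"
    proof (rule ccontr)
      assume "w \<notin> ?X"
      then have w': "w \<in> Z1" "w c0 = c" using w(1) by (auto simp: Z1_def)
      have "agree c0 w h'"
        unfolding agree_def h'_def using above[OF Z1(1,2)[OF w'(1)]] Z1(3)[OF w'(1)] w'(2) by auto
      then show False using w(2) by simp
    qed
  qed
  moreover have X: "countable ?X" using Z(3) c0 c by auto
  ultimately have "countable {w\<in>V. \<not> agree c0 w h'}" by (rule countable_subset)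
  then have "c0 \<in> D" using c0S unfolding D_def by auto
  then obtain w where w: "w \<in> V" "w \<notin> ?X" "agree c0 w hb"
    using ex2[OF X hbD] by auto
  then have "w \<in> Z1" by (auto simp: Z1_def)
  then have "w c0 \<noteq> hb c0" using k(2)[OF Z1(1,2)] Z1(3) by auto
  then show False using w(3) c0S unfolding agree_def by auto
qed

lemma supp_uminus: "supp (\<lambda>x. - f x) = supp f"
  by (simp add: supp_def)

lemma short_hahn:
  assumes S: "slin R S" and sh: "short R S"
  shows "short (series_less R) (hahn R S)"
  unfolding short_def
proof (intro allI impI)
  fix W assume W: "W \<subseteq> hahn R S" "rwo (series_less R) W \<or> rwo (series_less R)\<inverse>\<inverse> W"
  show "countable W"
  proof (cases "rwo (series_less R)\<inverse>\<inverse> W")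
    case True then show ?thesis using hahn_wo_countable[OF S sh W(1)] by auto
  next
    case False
    then have r: "rwo (series_less R) W" using W(2) by auto
    let ?n = "\<lambda>f x. - f x :: real"
    have "rwo (series_less R)\<inverse>\<inverse> (?n ` W)"
    proof (rule rwo_image[OF r])
      fix a b assume "series_less R a b"
      then obtain m where m: "a m < b m" "\<And>m'. a m' \<noteq> b m' \<Longrightarrow> m' = m \<or> R m' m"
        unfolding series_less_def by auto
      have "series_less R (?n b) (?n a)"
        unfolding series_less_def using m by (intro exI[of _ m]) force
      then show "?n a = ?n b \<or> (series_less R)\<inverse>\<inverse> (?n a) (?n b)" by auto
    qed
    moreover have "?n ` W \<subseteq> hahn R S" using W(1) by (fastforce simp: hahn_def supp_uminus)
    ultimately have "countable (?n ` W)" using hahn_wo_countable[OF S sh] by auto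
    moreover have "inj_on ?n W" by (auto simp: inj_on_def fun_eq_iff)
    ultimately show ?thesis using countable_image_inj_on by auto
  qed
qed

text \<open>The exponential monomials are \<open>x\<^sup>b exp f\<close> with \<open>b\<close> real and \<open>f\<close> a purely infinite series whose
  monomials have been constructed before. Since a datatype cannot recurse through
  \<open>pre \<Rightarrow> real\<close>, \<open>f\<close> is stored as the countable set \<open>graph f\<close> of its terms, from which \<open>coef\<close>
  recovers \<open>f\<close>. The datatype also has junk elements; the monomials proper are the elements
  of \<open>pre_emonos n\<close>.\<close>

datatype pre = Pre (pxpow: real) (pgraph: "(pre \<times> real) cset")

definition coef :: "('a \<times> real) cset \<Rightarrow> 'a \<Rightarrow> real" where
  "coef L m = (\<Sum>r | cin (m, r) L. r)"

definition graph :: "('a \<Rightarrow> real) \<Rightarrow> ('a \<times> real) cset" where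
  "graph f = acset ((\<lambda>m. (m, f m)) ` supp f)"

definition pexpo :: "pre \<Rightarrow> pre \<Rightarrow> real" where
  "pexpo g = coef (pgraph g)"

definition pmon :: "real \<Rightarrow> (pre \<Rightarrow> real) \<Rightarrow> pre" where
  "pmon b f = Pre b (graph f)"

lemma series_less_mono [mono]: "R \<le> Q \<Longrightarrow> series_less R f g \<longrightarrow> series_less Q f g"
  unfolding series_less_def by blast

text \<open>The order of the monomials: \<open>x\<^sup>b exp f < x\<^sup>c exp h\<close> iff \<open>f < h\<close>, or \<open>f = h\<close> and \<open>b < c\<close>.\<close>

inductive pless :: "pre \<Rightarrow> pre \<Rightarrow> bool" where
  pless_xpow: "pexpo g = pexpo h \<Longrightarrow> pxpow g < pxpow h \<Longrightarrow> pless g h"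
| pless_expo: "series_less pless (pexpo g) (pexpo h) \<Longrightarrow> pless g h"

text \<open>\<open>G\<^sub>0 = x\<^sup>\<real>\<close> and \<open>G\<^sub>n\<^sub>+\<^sub>1 = x\<^sup>\<real> exp(J\<^sub>n)\<close>, where \<open>J\<^sub>n\<close> is the group of the purely infinite elements
  (all monomials \<open>> 1\<close>) of \<open>K\<^sub>n = \<real>((G\<^sub>n))\<close>. In the notation of van den Dries, Macintyre and Marker,
  \<open>K\<^sub>n\<^sub>+\<^sub>1 = K\<^sub>n((exp(A\<^sub>n)))\<close> with \<open>A\<^sub>n\<close> the elements of \<open>K\<^sub>n\<close> that are purely infinite over
  \<open>K\<^sub>n\<^sub>-\<^sub>1\<close>; there \<open>J\<^sub>n = A\<^sub>0 \<oplus> \<dots> \<oplus> A\<^sub>n\<close> and \<open>G\<^sub>n\<^sub>+\<^sub>1 = G\<^sub>n exp(A\<^sub>n) = x\<^sup>\<real> exp(A\<^sub>0 \<oplus> \<dots> \<oplus> A\<^sub>n)\<close>.\<close>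

primrec pre_emonos :: "nat \<Rightarrow> pre set" where
  "pre_emonos 0 = {pmon b (\<lambda>_. 0) |b. True}"
| "pre_emonos (Suc n) = {pmon b f |b f. f \<in> hahn pless (pre_emonos n) \<and> (\<forall>m\<in>supp f. pless (pmon 0 (\<lambda>_. 0)) m)}"

lemma coef_graph: "countable (supp f) \<Longrightarrow> coef (graph f) = f"
proof
  fix m assume c: "countable (supp f)"
  have "{r. cin (m, r) (graph f)} = (if f m = 0 then {} else {f m})"
    unfolding graph_def cin.rep_eq using c by (auto simp: supp_def)
  then show "coef (graph f) m = f m" by (simp add: coef_def)
qed

lemma pexpo_pmon: "countable (supp f) \<Longrightarrow> pexpo (pmon b f) = f"
  by (simp add: pexpo_def pmon_def coef_graph)

lemma pxpow_pmon [simp]: "pxpow (pmon b f) = b"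
  by (simp add: pmon_def)

lemma supp_zero [simp]: "supp (\<lambda>_. 0) = {}"
  by (simp add: supp_def)

lemma pexpo_pmon0 [simp]: "pexpo (pmon b (\<lambda>_. 0)) = (\<lambda>_. 0)"
  by (simp add: pexpo_pmon)

lemma hahn_zero: "(\<lambda>_. 0) \<in> hahn R S"
  by (simp add: hahn_def rwo_def)

lemma pG_mono: "pre_emonos n \<subseteq> pre_emonos (Suc n)"
proof (induction n)
  case 0 show ?case using hahn_zero by fastforce
next
  case (Suc n)
  show ?case
  proof
    fix g assume "g \<in> pre_emonos (Suc n)"
    then obtain b f where g: "g = pmon b f" "f \<in> hahn pless (pre_emonos n)"
      and f: "\<forall>m\<in>supp f. pless (pmon 0 (\<lambda>_. 0)) m" by auto
    have "f \<in> hahn pless (pre_emonos (Suc n))" using g(2) hahn_mono[OF Suc] by auto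
    then show "g \<in> pre_emonos (Suc (Suc n))" using g(1) f by (subst pre_emonos.simps) blast
  qed
qed

lemma pG_mono_le: "m \<le> n \<Longrightarrow> pre_emonos m \<subseteq> pre_emonos n"
  by (rule lift_Suc_mono_le[of pre_emonos]) (rule pG_mono)

lemma pless_iff: "pless g h \<longleftrightarrow> pexpo g = pexpo h \<and> pxpow g < pxpow h \<or> series_less pless (pexpo g) (pexpo h)"
  by (subst pless.simps) auto

lemma rwo_lex_countable:
  assumes L: "slin L (e ` W)" and sh: "short L (e ` W)"
    and W: "rwo P W" and inj: "inj_on (\<lambda>w. (e w, x w)) W"
    and P: "\<And>u v. u \<in> W \<Longrightarrow> v \<in> W \<Longrightarrow> P u v \<Longrightarrow> e u = e v \<and> (x u :: real) > x v \<or> L (e v) (e u)"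
  shows "countable W"
proof -
  have "rwo L\<inverse>\<inverse> (e ` W)"
    by (rule rwo_image[OF W]) (use P in auto)
  then have c: "countable (e ` W)" using shortD[OF sh] by auto
  have f: "countable {w\<in>W. e w = f}" if "f \<in> e ` W" for f
  proof -
    have "rwo (>) (x ` {w\<in>W. e w = f})"
    proof (rule rwo_image[OF rwo_subset[OF W]])
      fix a b assume ab: "a \<in> {w\<in>W. e w = f}" "b \<in> {w\<in>W. e w = f}" "P a b"
      then show "x a = x b \<or> x a > x b"
        using P[of a b] slin_irrefl[OF L that] by auto
    qed auto
    then have "countable (x ` {w\<in>W. e w = f})" by (rule wo_real_countable)
    moreover have "inj_on x {w\<in>W. e w = f}" using inj by (auto simp: inj_on_def)
    ultimately show ?thesis by (rule countable_image_inj_on)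
  qed
  have "W \<subseteq> (\<Union>f\<in>e ` W. {w\<in>W. e w = f})" by auto
  then show ?thesis by (rule countable_subset) (rule countable_UN[OF c f])
qed

lemma short_subset: "slin R S \<Longrightarrow> short R S \<Longrightarrow> T \<subseteq> S \<Longrightarrow> short R T"
  unfolding short_def by (meson subset_trans)

lemma short_conv: "short R S \<Longrightarrow> short R\<inverse>\<inverse> S"
  unfolding short_def conversep_conversep by meson

lemma slin_short_lex:
  assumes HL: "slin L H" "short L H" and e: "e ` W \<subseteq> H" and inj: "inj_on (\<lambda>w. (e w, x w)) W"
    and P: "\<And>u v. u \<in> W \<Longrightarrow> v \<in> W \<Longrightarrow> P u v \<longleftrightarrow> e u = e v \<and> (x u :: real) < x v \<or> L (e u) (e v)"
  shows "slin P W" "short P W"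
proof -
  have eH: "e u \<in> H" if "u \<in> W" for u using that e by auto
  show "slin P W" unfolding slin_def irreflp_on_def transp_on_def totalp_on_def
  proof (intro conjI ballI impI)
    fix a assume "a \<in> W" then show "\<not> P a a" using P slin_irrefl[OF HL(1) eH] by auto
  next
    fix a b c assume "a \<in> W" "b \<in> W" "c \<in> W" "P a b" "P b c"
    then show "P a c" using P[of a b] P[of b c] P[of a c] slin_trans[OF HL(1) eH eH eH, of a b c] by auto
  next
    fix a b assume ab: "a \<in> W" "b \<in> W" "a \<noteq> b"
    then have "e a \<noteq> e b \<or> x a \<noteq> x b" using inj by (auto simp: inj_on_def)
    then show "P a b \<or> P b a" using P[of a b] P[of b a] ab slin_total[OF HL(1) eH eH, of a b] by auto
  qed
  show "short P W" unfolding short_def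
  proof (intro allI impI)
    fix A assume A: "A \<subseteq> W" "rwo P A \<or> rwo P\<inverse>\<inverse> A"
    have sub: "e ` A \<subseteq> H" using A(1) e by auto
    have l: "slin L (e ` A)" "short L (e ` A)"
      using slin_subset[OF HL(1) sub] short_subset[OF HL sub] by auto
    have PA: "P u v \<longleftrightarrow> e u = e v \<and> x u < x v \<or> L (e u) (e v)" if "u \<in> A" "v \<in> A" for u v
      using P that A(1) by auto
    have i: "inj_on (\<lambda>w. (e w, x w)) A" using inj A(1) by (auto simp: inj_on_def)
    have i': "inj_on (\<lambda>w. (e w, - x w)) A" using inj A(1) by (auto simp: inj_on_def)
    show "countable A"
    proof (cases "rwo P A")
      case True
      show ?thesis
        by (rule rwo_lex_countable[OF slin_conv[OF l(1)] short_conv[OF l(2)] True i'])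
          (use PA in auto)
    next
      case False
      then have "rwo P\<inverse>\<inverse> A" using A(2) by auto
      then show ?thesis
        by (rule rwo_lex_countable[OF l _ i]) (use PA in auto)
    qed
  qed
qed

lemma slin_short_pG: "slin pless (pre_emonos n) \<and> short pless (pre_emonos n)"
proof (induction n)
  case 0
  have H: "slin (\<lambda>_ _. False) {\<lambda>_::pre. 0::real}" "short (\<lambda>_ _. False) {\<lambda>_::pre. 0::real}"
    unfolding slin_def short_def irreflp_on_def transp_on_def totalp_on_def
    using countable_subset[of _ "{\<lambda>_::pre. 0::real}"] by simp_all
  have 1: "pexpo ` pre_emonos 0 \<subseteq> {\<lambda>_. 0}" by auto
  have 2: "inj_on (\<lambda>w. (pexpo w, pxpow w)) (pre_emonos 0)" by (auto simp: inj_on_def)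
  have 3: "pless u v \<longleftrightarrow> pexpo u = pexpo v \<and> pxpow u < pxpow v \<or> False" if "u \<in> pre_emonos 0" "v \<in> pre_emonos 0" for u v
    using that by (auto simp: pless_iff[of u v] series_less_def)
  show ?case using slin_short_lex[OF H 1 2 3] by simp
next
  case (Suc n)
  then have S: "slin pless (pre_emonos n)" "short pless (pre_emonos n)" by auto
  have c: "countable (supp f)" if "f \<in> hahn pless (pre_emonos n)" for f
    using shortD[OF S(2)] that unfolding hahn_def by auto
  have 1: "pexpo ` pre_emonos (Suc n) \<subseteq> hahn pless (pre_emonos n)" using pexpo_pmon[OF c] by auto
  have 2: "inj_on (\<lambda>w. (pexpo w, pxpow w)) (pre_emonos (Suc n))" using pexpo_pmon[OF c] by (auto simp: inj_on_def)
  show ?case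
    using slin_short_lex[OF slin_hahn[OF S(1)] short_hahn[OF S] 1 2 pless_iff] by simp
qed

lemmas slin_pG = slin_short_pG[THEN conjunct1]

text \<open>Supports are automatically countable, so by \<open>coef_graph\<close> the encoding loses no series.\<close>

lemma countable_supp_hahn: "f \<in> hahn pless (pre_emonos n) \<Longrightarrow> countable (supp f)"
  using shortD[OF slin_short_pG[THEN conjunct2]] unfolding hahn_def by auto

definition pre_emono :: "pre set" where
  "pre_emono = (\<Union>n. pre_emonos n)"

abbreviation pone :: pre where "pone \<equiv> pmon 0 (\<lambda>_. 0)"
abbreviation px :: pre where "px \<equiv> pmon 1 (\<lambda>_. 0)"

lemma pmon0_in [simp]: "pmon b (\<lambda>_. 0) \<in> pre_emonos n"
  using pG_mono_le[of 0 n] by auto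

lemma pE_level: "g \<in> pre_emono \<Longrightarrow> h \<in> pre_emono \<Longrightarrow> k \<in> pre_emono \<Longrightarrow> \<exists>n. g \<in> pre_emonos n \<and> h \<in> pre_emonos n \<and> k \<in> pre_emonos n"
proof -
  assume "g \<in> pre_emono" "h \<in> pre_emono" "k \<in> pre_emono"
  then obtain a b c where "g \<in> pre_emonos a" "h \<in> pre_emonos b" "k \<in> pre_emonos c" unfolding pre_emono_def by auto
  then have "g \<in> pre_emonos (a + b + c)" "h \<in> pre_emonos (a + b + c)" "k \<in> pre_emonos (a + b + c)"
    using pG_mono_le[of a "a + b + c"] pG_mono_le[of b "a + b + c"]
      pG_mono_le[of c "a + b + c"] by auto
  then show ?thesis by auto
qed

lemma slin_pE: "slin pless pre_emono"
  unfolding slin_def irreflp_on_def transp_on_def totalp_on_def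
proof (intro conjI ballI impI)
  fix a assume "a \<in> pre_emono" then show "\<not> pless a a"
    using pE_level[of a a a] slin_irrefl[OF slin_pG] by auto
next
  fix a b c assume "a \<in> pre_emono" "b \<in> pre_emono" "c \<in> pre_emono" "pless a b" "pless b c"
  then show "pless a c" using pE_level[of a b c] slin_trans[OF slin_pG] by blast
next
  fix a b assume "a \<in> pre_emono" "b \<in> pre_emono" "a \<noteq> b"
  then show "pless a b \<or> pless b a" using pE_level[of a b b] slin_total[OF slin_pG] by blast
qed

lemma pG_SucD:
  assumes "g \<in> pre_emonos (Suc n)"
  shows "pexpo g \<in> hahn pless (pre_emonos n)" "m \<in> supp (pexpo g) \<Longrightarrow> pless pone m"
    "pmon (pxpow g) (pexpo g) = g"
  using assms pexpo_pmon[OF countable_supp_hahn] by auto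

lemma pG_SucI:
  "f \<in> hahn pless (pre_emonos n) \<Longrightarrow> (\<And>m. m \<in> supp f \<Longrightarrow> pless pone m) \<Longrightarrow> pmon b f \<in> pre_emonos (Suc n)"
  by auto

declare pre_emonos.simps(2) [simp del]

lemma supp_add: "supp (\<lambda>x. f x + g x) \<subseteq> supp f \<union> supp g"
  by (auto simp: supp_def)

lemma hahn_add:
  assumes "slin R S" "f \<in> hahn R S" "g \<in> hahn R S"
  shows "(\<lambda>x. f x + g x) \<in> hahn R S"
proof -
  have "rwo R (supp f \<union> supp g)"
    using assms unfolding hahn_def by (intro rwo_Un[OF assms(1)]) auto
  then have "rwo R (supp (\<lambda>x. f x + g x))" using rwo_subset[OF _ supp_add] by auto
  moreover have "supp (\<lambda>x. f x + g x) \<subseteq> S" using supp_add[of f g] assms(2,3) unfolding hahn_def by auto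
  ultimately show ?thesis unfolding hahn_def by auto
qed

lemma hahn_uminus: "f \<in> hahn R S \<Longrightarrow> (\<lambda>x. - f x) \<in> hahn R S"
  by (simp add: hahn_def supp_uminus)

lemma pE_SucE:
  assumes "g \<in> pre_emono" "h \<in> pre_emono" "k \<in> pre_emono"
  obtains n where "g \<in> pre_emonos (Suc n)" "h \<in> pre_emonos (Suc n)" "k \<in> pre_emonos (Suc n)"
proof -
  obtain n where "g \<in> pre_emonos n" "h \<in> pre_emonos n" "k \<in> pre_emonos n" using pE_level[OF assms] by auto
  then show thesis using that[of n] pG_mono[of n] by auto
qed

lemma pG_pE: "g \<in> pre_emonos n \<Longrightarrow> g \<in> pre_emono"
  unfolding pre_emono_def by auto

definition pmul :: "pre \<Rightarrow> pre \<Rightarrow> pre" where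
  "pmul g h = pmon (pxpow g + pxpow h) (\<lambda>m. pexpo g m + pexpo h m)"

definition pinv :: "pre \<Rightarrow> pre" where
  "pinv g = pmon (- pxpow g) (\<lambda>m. - pexpo g m)"

lemma pmul_pG: "g \<in> pre_emonos n \<Longrightarrow> h \<in> pre_emonos n \<Longrightarrow> pmul g h \<in> pre_emonos n"
proof (cases n)
  case (Suc k)
  assume "g \<in> pre_emonos n" "h \<in> pre_emonos n"
  then have gh: "g \<in> pre_emonos (Suc k)" "h \<in> pre_emonos (Suc k)" using Suc by auto
  have "pless pone m" if "m \<in> supp (\<lambda>m. pexpo g m + pexpo h m)" for m
    using subsetD[OF supp_add that] pG_SucD(2)[OF gh(1)] pG_SucD(2)[OF gh(2)] by auto
  then show ?thesis unfolding Suc pmul_def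
    by (intro pG_SucI hahn_add[OF slin_pG] pG_SucD(1) gh)
qed (auto simp: pmul_def)

lemma pinv_pG: "g \<in> pre_emonos n \<Longrightarrow> pinv g \<in> pre_emonos n"
proof (cases n)
  case (Suc k)
  assume "g \<in> pre_emonos n"
  then have g: "g \<in> pre_emonos (Suc k)" using Suc by auto
  have "pless pone m" if "m \<in> supp (\<lambda>m. - pexpo g m)" for m
    using that pG_SucD(2)[OF g] by (simp add: supp_uminus)
  then show ?thesis unfolding Suc pinv_def
    by (intro pG_SucI hahn_uminus pG_SucD(1) g)
qed (auto simp: pinv_def)

lemma pmul_pE: "g \<in> pre_emono \<Longrightarrow> h \<in> pre_emono \<Longrightarrow> pmul g h \<in> pre_emono"
  by (rule pE_SucE[of g h h]) (auto intro: pmul_pG pG_pE)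

lemma pinv_pE: "g \<in> pre_emono \<Longrightarrow> pinv g \<in> pre_emono"
  by (rule pE_SucE[of g g g]) (auto intro: pinv_pG pG_pE)

lemma pE_countable: "g \<in> pre_emono \<Longrightarrow> countable (supp (pexpo g))"
  by (rule pE_SucE[of g g g]) (auto intro: countable_supp_hahn pG_SucD(1))

lemma pexpo_pmul: "g \<in> pre_emono \<Longrightarrow> h \<in> pre_emono \<Longrightarrow> pexpo (pmul g h) = (\<lambda>m. pexpo g m + pexpo h m)"
  unfolding pmul_def
  by (intro pexpo_pmon countable_subset[OF supp_add]) (auto simp: pE_countable)

lemma pexpo_pinv: "g \<in> pre_emono \<Longrightarrow> pexpo (pinv g) = (\<lambda>m. - pexpo g m)"
  unfolding pinv_def by (intro pexpo_pmon) (auto simp: pE_countable supp_uminus)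

lemma pxpow_pmul [simp]: "pxpow (pmul g h) = pxpow g + pxpow h"
  by (simp add: pmul_def)

lemma pxpow_pinv [simp]: "pxpow (pinv g) = - pxpow g"
  by (simp add: pinv_def)

lemma pE_eqI: "g \<in> pre_emono \<Longrightarrow> h \<in> pre_emono \<Longrightarrow> pxpow g = pxpow h \<Longrightarrow> pexpo g = pexpo h \<Longrightarrow> g = h"
proof -
  assume a: "g \<in> pre_emono" "h \<in> pre_emono" "pxpow g = pxpow h" "pexpo g = pexpo h"
  obtain n where n: "g \<in> pre_emonos (Suc n)" "h \<in> pre_emonos (Suc n)" by (rule pE_SucE[OF a(1,2,2)])
  have "g = pmon (pxpow g) (pexpo g)" using pG_SucD(3)[OF n(1)] by (rule sym)
  also have "\<dots> = h" using pG_SucD(3)[OF n(2)] by (simp only: a(3,4))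
  finally show "g = h" .
qed

lemma pless_expoI:
  assumes "pexpo g m < pexpo h m" "\<And>x. pexpo g x \<noteq> pexpo h x \<Longrightarrow> x = m \<or> pless x m"
  shows "pless g h"
  by (rule pless_expo) (unfold series_less_def, use assms in blast)

lemma pless_pmul:
  assumes "g \<in> pre_emono" "h \<in> pre_emono" "k \<in> pre_emono" "pless g h"
  shows "pless (pmul k g) (pmul k h)"
proof -
  have "pexpo (pmul k g) = pexpo (pmul k h) \<longleftrightarrow> pexpo g = pexpo h"
    by (simp add: pexpo_pmul assms fun_eq_iff)
  moreover have "series_less pless (pexpo (pmul k g)) (pexpo (pmul k h)) \<longleftrightarrow> series_less pless (pexpo g) (pexpo h)"
    by (simp add: pexpo_pmul assms series_less_def)
  ultimately show ?thesis
    using assms(4) unfolding pless_iff[of g h] pless_iff[of "pmul k g"] by simp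
qed

lemma px_neq: "pxpow g = 0 \<Longrightarrow> g \<noteq> px"
  by auto

text \<open>The substitution \<open>x \<mapsto> exp x\<close>, which maps \<open>x\<^sup>b exp f\<close> to \<open>exp(b x + f(exp x))\<close>.\<close>

primrec pre_up :: "pre \<Rightarrow> pre" where
  "pre_up (Pre b L) = Pre 0 (cUn (if b = 0 then cempty else csingle (px, b)) (cimage (map_prod pre_up id) L))"

lemma pxpow_pup [simp]: "pxpow (pre_up g) = 0"
  by (cases g) simp

lemma pup_neq_px [simp]: "pre_up g \<noteq> px" "px \<noteq> pre_up g"
  using px_neq[of "pre_up g"] by auto

lemma cin_pup:
  "cin (y, r) (pgraph (pre_up g)) \<longleftrightarrow> y = px \<and> r = pxpow g \<and> r \<noteq> 0 \<or> (\<exists>m. y = pre_up m \<and> cin (m, r) (pgraph g))"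
proof (cases g)
  case (Pre b L)
  have "(y, r) \<in> map_prod pre_up id ` rcset L \<longleftrightarrow> (\<exists>m. y = pre_up m \<and> (m, r) \<in> rcset L)" by force
  then show ?thesis
    by (auto simp: Pre cin.rep_eq sup_cset.rep_eq cimage.rep_eq cinsert.rep_eq bot_cset.rep_eq)
qed

declare pre_up.simps [simp del]

lemma pup_inj: "pre_up g = pre_up h \<Longrightarrow> g = h"
proof (induction g arbitrary: h)
  case (Pre b L)
  obtain c K where h: "h = Pre c K" by (cases h)
  have eq: "cin (y, r) (pgraph (pre_up (Pre b L))) \<longleftrightarrow> cin (y, r) (pgraph (pre_up h))" for y r
    using Pre.prems by simp
  have "b = c" using eq[of px b] eq[of px c] by (auto simp: cin_pup h)
  moreover have IH: "m = m'" if "cin (m, r) L" "pre_up m = pre_up m'" for m r m'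
    using Pre.IH[of "(m, r)" m m'] that by (simp add: cin.rep_eq)
  have "cin (m, r) L \<longleftrightarrow> cin (m, r) K" for m r
  proof
    assume m: "cin (m, r) L"
    then have "cin (pre_up m, r) (pgraph (pre_up h))" using eq[of "pre_up m" r] by (auto simp: cin_pup)
    then obtain m' where "pre_up m = pre_up m'" "cin (m', r) K" by (auto simp: cin_pup h)
    then show "cin (m, r) K" using IH[OF m] by auto
  next
    assume m: "cin (m, r) K"
    then have "cin (pre_up m, r) (pgraph (pre_up (Pre b L)))" using eq[of "pre_up m" r] by (auto simp: cin_pup h)
    then obtain m' where m': "pre_up m = pre_up m'" "cin (m', r) L" by (auto simp: cin_pup)
    then show "cin (m, r) L" using IH[OF m'(2) m'(1)[symmetric]] by simp
  qed
  then have "L = K" by (intro cset_eqI) auto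
  ultimately show ?case using h by simp
qed

lemma pexpo_pup:
  "pexpo (pre_up g) (pre_up m) = pexpo g m"
  "pexpo (pre_up g) px = pxpow g"
  "y \<noteq> px \<Longrightarrow> y \<notin> range pre_up \<Longrightarrow> pexpo (pre_up g) y = 0"
proof -
  have "{r. cin (pre_up m, r) (pgraph (pre_up g))} = {r. cin (m, r) (pgraph g)}"
    by (auto simp: cin_pup dest: pup_inj)
  then show "pexpo (pre_up g) (pre_up m) = pexpo g m" by (simp add: pexpo_def coef_def)
  have "{r. cin (px, r) (pgraph (pre_up g))} = (if pxpow g = 0 then {} else {pxpow g})"
    by (auto simp: cin_pup)
  then show "pexpo (pre_up g) px = pxpow g" by (simp add: pexpo_def coef_def)
  assume "y \<noteq> px" "y \<notin> range pre_up"
  then have "{r. cin (y, r) (pgraph (pre_up g))} = {}" by (auto simp: cin_pup)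
  then show "pexpo (pre_up g) y = 0" by (simp only: pexpo_def coef_def) simp
qed

lemma pre_cases: obtains "y = px" | m where "y = pre_up m" | "y \<noteq> px" "y \<notin> range pre_up"
  by (cases "y = px"; cases "y \<in> range pre_up") auto

lemma graph_zero: "graph (\<lambda>_. 0) = cempty"
  by (simp add: graph_def bot_cset_def)

lemma pup_one [simp]: "pre_up pone = pone"
  by (simp add: pmon_def graph_zero pre_up.simps)

lemma pless_pup:
  "g \<in> pre_emonos n \<Longrightarrow> h \<in> pre_emonos n \<Longrightarrow> pless g h \<Longrightarrow> pless (pre_up g) (pre_up h)"
proof (induction n arbitrary: g h)
  case 0
  then have e: "pexpo g = (\<lambda>_. 0)" "pexpo h = (\<lambda>_. 0)" "pxpow g < pxpow h"
    by (auto simp: pless_iff[of g h] series_less_def)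
  show ?case
  proof (rule pless_expoI)
    show "pexpo (pre_up g) px < pexpo (pre_up h) px" using e(3) by (simp add: pexpo_pup)
    fix y assume "pexpo (pre_up g) y \<noteq> pexpo (pre_up h) y"
    then show "y = px \<or> pless y px" using e by (cases y rule: pre_cases) (auto simp: pexpo_pup)
  qed
next
  case (Suc n)
  from Suc.prems(3) consider (1) "pexpo g = pexpo h" "pxpow g < pxpow h"
    | (2) m where "pexpo g m < pexpo h m" "\<And>x. pexpo g x \<noteq> pexpo h x \<Longrightarrow> x = m \<or> pless x m"
    unfolding pless_iff[of g h] series_less_def by auto
  then show ?case
  proof cases
    case 1
    show ?thesis
    proof (rule pless_expoI)
      show "pexpo (pre_up g) px < pexpo (pre_up h) px" using 1(2) by (simp add: pexpo_pup)
      fix y assume "pexpo (pre_up g) y \<noteq> pexpo (pre_up h) y"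
      then show "y = px \<or> pless y px" using 1 by (cases y rule: pre_cases) (auto simp: pexpo_pup)
    qed
  next
    case 2
    note E = pG_SucD[OF Suc.prems(1)] pG_SucD[OF Suc.prems(2)]
    have in_n: "x \<in> pre_emonos n" if "pexpo g x \<noteq> pexpo h x" for x
      using hahn_supp_in[OF E(1,4) that] .
    have mn: "m \<in> pre_emonos n" using in_n[of m] 2(1) by auto
    have "pless pone m" using 2(1) E(2,5)[of m] unfolding supp_def by (cases "pexpo g m = 0") auto
    then have "pless pone (pre_up m)" using Suc.IH[of pone m] mn by simp
    then have xm: "pless px (pre_up m)"
      by (intro pless_expo) (simp add: pless_iff[of pone "pre_up m"])
    have "y = pre_up m \<or> pless y (pre_up m)" if d: "pexpo (pre_up g) y \<noteq> pexpo (pre_up h) y" for y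
    proof (cases y rule: pre_cases)
      case 1 then show ?thesis using xm by simp
    next
      case (2 x)
      then have x: "pexpo g x \<noteq> pexpo h x" using d by (simp add: pexpo_pup)
      then show ?thesis using \<open>\<And>x. pexpo g x \<noteq> pexpo h x \<Longrightarrow> x = m \<or> pless x m\<close>[OF x]
          Suc.IH[OF in_n[OF x] mn] 2 by auto
    next
      case 3 then show ?thesis using d by (simp add: pexpo_pup)
    qed
    moreover have "pexpo (pre_up g) (pre_up m) < pexpo (pre_up h) (pre_up m)" using 2(1) by (simp add: pexpo_pup)
    ultimately show ?thesis by (metis pless_expoI)
  qed
qed

lemma pless_one_px: "pless pone px"
  by (intro pless_xpow) auto

lemma graph_pexpo_pup:
  assumes "countable (supp (pexpo g))" "pgraph g = graph (pexpo g)"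
  shows "pre_up g = pmon 0 (pexpo (pre_up g))" "supp (pexpo (pre_up g)) \<subseteq> insert px (pre_up ` supp (pexpo g))"
proof -
  show sub: "supp (pexpo (pre_up g)) \<subseteq> insert px (pre_up ` supp (pexpo g))"
  proof
    fix y assume y: "y \<in> supp (pexpo (pre_up g))"
    then show "y \<in> insert px (pre_up ` supp (pexpo g))"
      by (cases y rule: pre_cases) (auto simp: supp_def pexpo_pup)
  qed
  then have c: "countable (supp (pexpo (pre_up g)))" using assms(1) countable_subset by fastforce
  have g: "cin (m, r) (pgraph g) \<longleftrightarrow> r = pexpo g m \<and> r \<noteq> 0" for m r
    unfolding assms(2) graph_def cin.rep_eq using assms(1) by (auto simp: supp_def)
  have "cin (y, r) (pgraph (pre_up g)) \<longleftrightarrow> cin (y, r) (graph (pexpo (pre_up g)))" for y r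
  proof -
    have "cin (y, r) (graph (pexpo (pre_up g))) \<longleftrightarrow> r = pexpo (pre_up g) y \<and> r \<noteq> 0"
      unfolding graph_def cin.rep_eq using c by (auto simp: supp_def)
    then show ?thesis
      by (cases y rule: pre_cases) (auto simp: cin_pup g pexpo_pup dest: pup_inj)
  qed
  then have "pgraph (pre_up g) = graph (pexpo (pre_up g))" by (intro cset_eqI) auto
  then show "pre_up g = pmon 0 (pexpo (pre_up g))" unfolding pmon_def
    by (metis pre.collapse pxpow_pup)
qed

lemma pup_pG: "g \<in> pre_emonos n \<Longrightarrow> pre_up g \<in> pre_emonos (Suc n)"
proof (induction n arbitrary: g)
  case 0
  then have e: "pexpo g = (\<lambda>_. 0)" "pgraph g = graph (pexpo g)"
    by (auto simp: pmon_def[of _ "\<lambda>_. 0"] pexpo_def coef_graph)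
  have *: "pre_up g = pmon 0 (pexpo (pre_up g))" "supp (pexpo (pre_up g)) \<subseteq> {px}"
    using graph_pexpo_pup[of g] e by auto
  have "rwo pless (supp (pexpo (pre_up g)))"
    using *(2) unfolding rwo_def by blast
  then have "pexpo (pre_up g) \<in> hahn pless (pre_emonos 0)" using *(2) unfolding hahn_def by auto
  then show ?case using *(2) pless_one_px by (subst *(1), intro pG_SucI) auto
next
  case (Suc n)
  note E = pG_SucD[OF Suc.prems]
  let ?f = "pexpo g"
  have cf: "countable (supp ?f)" using countable_supp_hahn[OF E(1)] .
  have "pgraph g = graph ?f" using E(3) by (metis pmon_def pre.sel(2))
  note * = graph_pexpo_pup[OF cf this]
  have sn: "supp ?f \<subseteq> pre_emonos n" "rwo pless (supp ?f)" using E(1) unfolding hahn_def by auto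
  have i: "pre_up ` supp ?f \<subseteq> pre_emonos (Suc n)" using sn(1) Suc.IH by auto
  have "rwo pless (pre_up ` supp ?f)"
    by (rule rwo_image[OF sn(2)]) (use pless_pup[of _ n] sn(1) in auto)
  moreover have "rwo pless {px}" unfolding rwo_def by blast
  ultimately have "rwo pless ({px} \<union> pre_up ` supp ?f)"
    by (intro rwo_Un[OF slin_pG[of "Suc n"] _ i]) simp_all
  then have "rwo pless (supp (pexpo (pre_up g)))" using rwo_subset *(2) by auto
  then have "pexpo (pre_up g) \<in> hahn pless (pre_emonos (Suc n))" using order_trans[OF *(2)] i unfolding hahn_def by auto
  moreover have "pless pone m" if m: "m \<in> supp (pexpo (pre_up g))" for m
  proof (cases "m = px")
    case False
    then obtain k where k: "k \<in> supp ?f" "m = pre_up k" using subsetD[OF *(2) m] by auto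
    then show ?thesis using pless_pup[of pone n k] sn(1) E(2)[OF k(1)] by auto
  qed (simp add: pless_one_px)
  ultimately show ?case by (subst *(1), intro pG_SucI)
qed

lemma pup_pE: "g \<in> pre_emono \<Longrightarrow> pre_up g \<in> pre_emono"
  by (rule pE_SucE[of g g g]) (auto intro: pup_pG pG_pE)

lemma pup_pmul: "g \<in> pre_emono \<Longrightarrow> h \<in> pre_emono \<Longrightarrow> pre_up (pmul g h) = pmul (pre_up g) (pre_up h)"
proof (rule pE_eqI)
  assume gh: "g \<in> pre_emono" "h \<in> pre_emono"
  show "pexpo (pre_up (pmul g h)) = pexpo (pmul (pre_up g) (pre_up h))"
  proof
    fix y show "pexpo (pre_up (pmul g h)) y = pexpo (pmul (pre_up g) (pre_up h)) y"
      by (cases y rule: pre_cases) (auto simp: pexpo_pmul pup_pE gh pexpo_pup)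
  qed
qed (auto intro: pup_pE pmul_pE)

text \<open>The ordered group of the monomials of the field of exponential series. Groups of monomials
  are written additively: \<open>0\<close> is the monomial \<open>1\<close> and \<open>+\<close> is the product of monomials.\<close>

typedef emono = pre_emono morphisms rep_emono Abs_emono
  using pG_pE[OF pmon0_in] by auto

setup_lifting type_definition_emono

instantiation emono :: linordered_ab_group_add
begin

lift_definition zero_emono :: emono is pone using pG_pE[OF pmon0_in] .
lift_definition plus_emono :: "emono \<Rightarrow> emono \<Rightarrow> emono" is pmul by (rule pmul_pE)
lift_definition uminus_emono :: "emono \<Rightarrow> emono" is pinv by (rule pinv_pE)
definition minus_emono :: "emono \<Rightarrow> emono \<Rightarrow> emono" where "minus_emono g h = g + - h"
lift_definition less_emono :: "emono \<Rightarrow> emono \<Rightarrow> bool" is pless .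
definition less_eq_emono :: "emono \<Rightarrow> emono \<Rightarrow> bool" where "less_eq_emono g h \<longleftrightarrow> g = h \<or> g < h"

instance
proof
  have irr: "\<not> a < a" for a :: emono by transfer (rule slin_irrefl[OF slin_pE])
  have tr: "a < b \<Longrightarrow> b < c \<Longrightarrow> a < c" for a b c :: emono by transfer (rule slin_trans[OF slin_pE])
  have tot: "a = b \<or> a < b \<or> b < a" for a b :: emono by transfer (use slin_total[OF slin_pE] in blast)
  have mono: "a < b \<Longrightarrow> c + a < c + b" for a b c :: emono by transfer (rule pless_pmul)
  fix a b c :: emono
  show "a + b + c = a + (b + c)"
    by transfer (auto intro!: pE_eqI pmul_pE simp: pexpo_pmul pmul_pE algebra_simps)
  show "a + b = b + a"
    by transfer (auto intro!: pE_eqI pmul_pE simp: pexpo_pmul pmul_pE algebra_simps)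
  show "0 + a = a"
    by transfer (auto intro!: pE_eqI pmul_pE simp: pexpo_pmul pmul_pE pG_pE[OF pmon0_in])
  show "- a + a = 0"
    by transfer (auto intro!: pE_eqI pmul_pE pinv_pE simp: pexpo_pmul pexpo_pinv pmul_pE pinv_pE pG_pE[OF pmon0_in])
  show "a - b = a + - b" by (rule minus_emono_def)
  show "a \<le> a" by (simp add: less_eq_emono_def)
  show "(a < b) = (a \<le> b \<and> \<not> b \<le> a)" unfolding less_eq_emono_def using irr tr[of a b a] by auto
  show "a \<le> b \<Longrightarrow> b \<le> c \<Longrightarrow> a \<le> c" unfolding less_eq_emono_def using tr[of a b c] by auto
  show "a \<le> b \<Longrightarrow> b \<le> a \<Longrightarrow> a = b" unfolding less_eq_emono_def using irr[of a] tr[of a b a] by auto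
  show "a \<le> b \<or> b \<le> a" unfolding less_eq_emono_def using tot[of a b] by auto
  show "a \<le> b \<Longrightarrow> c + a \<le> c + b" unfolding less_eq_emono_def using mono[of a b c] by auto
qed

end

definition emonos :: "nat \<Rightarrow> emono set" where
  "emonos n = {g. rep_emono g \<in> pre_emonos n}"

lift_definition up :: "emono \<Rightarrow> emono" is pre_up by (rule pup_pE)

lemma up_inj: "up g = up h \<Longrightarrow> g = h"
  by transfer (rule pup_inj)

lemma up_less: "g < h \<Longrightarrow> up g < up h"
proof transfer
  fix g h assume a: "g \<in> pre_emono" "h \<in> pre_emono" "pless g h"
  obtain n where "g \<in> pre_emonos (Suc n)" "h \<in> pre_emonos (Suc n)" by (rule pE_SucE[OF a(1,2,2)])
  then show "pless (pre_up g) (pre_up h)" using a(3) by (rule pless_pup)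
qed

lemma up_add: "up (g + h) = up g + up h"
  by transfer (rule pup_pmul)

lemma up_G: "g \<in> emonos n \<Longrightarrow> up g \<in> emonos (Suc n)"
  by (simp add: emonos_def up.rep_eq pup_pG)

lemma G_mono: "m \<le> n \<Longrightarrow> emonos m \<subseteq> emonos n"
  using pG_mono_le by (auto simp: emonos_def)

lemma G_add: "g \<in> emonos n \<Longrightarrow> h \<in> emonos n \<Longrightarrow> g + h \<in> emonos n"
  by (simp add: emonos_def plus_emono.rep_eq pmul_pG)

lemma upn_inj: "(up ^^ k) g = (up ^^ k) h \<longleftrightarrow> g = h"
  by (induction k) (auto dest: up_inj)

lemma upn_less: "(up ^^ k) g < (up ^^ k) h \<longleftrightarrow> g < h"
proof -
  have "g < h \<Longrightarrow> (up ^^ k) g < (up ^^ k) h" for g h by (induction k) (auto intro: up_less)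
  from this[of g h] this[of h g] show ?thesis using upn_inj[of k g h] by (cases g h rule: linorder_cases) auto
qed

lemma upn_add: "(up ^^ k) (g + h) = (up ^^ k) g + (up ^^ k) h"
  by (induction k) (auto simp: up_add)

lemma upn_zero: "(up ^^ k) 0 = 0"
  using upn_add[of k 0 0] by simp

lemma upn_uminus: "(up ^^ k) (- g) = - (up ^^ k) g"
  using upn_add[of k "- g" g] by (simp add: upn_zero eq_neg_iff_add_eq_0)

lemma upn_upn: "(up ^^ k) ((up ^^ l) g) = (up ^^ (k + l)) g"
  by (simp add: funpow_add)

lemma upn_G: "g \<in> emonos n \<Longrightarrow> (up ^^ k) g \<in> emonos (n + k)"
  by (induction k) (auto intro: up_G)

text \<open>The LE-monomials are the direct limit of the exponential monomials along \<open>up\<close>: the pair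
  \<open>(k, g)\<close> stands for \<open>g(log\<^sub>k x)\<close> with \<open>log\<^sub>k\<close> the \<open>k\<close>-fold iterated logarithm, and
  \<open>g(log\<^sub>k x) = (up g)(log\<^sub>k\<^sub>+\<^sub>1 x)\<close>.\<close>

definition same_lemono :: "nat \<times> emono \<Rightarrow> nat \<times> emono \<Rightarrow> bool" where
  "same_lemono = (\<lambda>(k, g) (l, h). (up ^^ l) g = (up ^^ k) h)"

lemma upn_cancel: "(up ^^ a) g < (up ^^ b) h \<longleftrightarrow> (up ^^ (c + a)) g < (up ^^ (c + b)) h"
  "(up ^^ a) g = (up ^^ b) h \<longleftrightarrow> (up ^^ (c + a)) g = (up ^^ (c + b)) h"
  by (simp_all add: funpow_add upn_less upn_inj)

quotient_type lemono = "nat \<times> emono" / same_lemono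
proof (rule equivpI)
  show "reflp same_lemono" by (auto simp: reflp_def same_lemono_def)
  show "symp same_lemono" by (auto simp: symp_def same_lemono_def)
  show "transp same_lemono"
  proof (rule transpI)
    fix p q r assume "same_lemono p q" "same_lemono q r"
    moreover obtain k g l h m e where p: "p = (k, g)" "q = (l, h)" "r = (m, e)" by (cases p, cases q, cases r)
    ultimately have "(up ^^ l) g = (up ^^ k) h" "(up ^^ m) h = (up ^^ l) e" by (auto simp: same_lemono_def)
    then have "(up ^^ (m + l)) g = (up ^^ (k + l)) e"
      by (metis add.commute upn_upn)
    then have "(up ^^ m) g = (up ^^ k) e" using upn_cancel(2)[of m g k e l] by (simp add: add.commute)
    then show "same_lemono p r" by (simp add: p same_lemono_def)
  qed
qed

lemma abs_lemono_eq: "abs_lemono (k, g) = abs_lemono (l, h) \<longleftrightarrow> (up ^^ l) g = (up ^^ k) h"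
  by (simp add: lemono.abs_eq_iff same_lemono_def)

lemma abs_lemono_shift: "abs_lemono (k, g) = abs_lemono (j + k, (up ^^ j) g)"
  by (simp add: abs_lemono_eq upn_upn add.commute)

lemma lemono_rep: obtains k g where "a = abs_lemono (k, g)"
proof (induct a rule: lemono.abs_induct)
  case (1 y) then show ?case by (cases y) auto
qed

lemma lemono_rep2:
  obtains k g h where "a = abs_lemono (k, g)" "b = abs_lemono (k, h)"
proof -
  obtain i g where a: "a = abs_lemono (i, g)" by (rule lemono_rep)
  obtain j h where b: "b = abs_lemono (j, h)" by (rule lemono_rep)
  from a b show thesis using that[of "j + i" "(up ^^ j) g" "(up ^^ i) h"]
    abs_lemono_shift[of i g j] abs_lemono_shift[of j h i] by (simp add: add.commute)
qed

lemma lemono_rep3: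
  obtains k g h e where "a = abs_lemono (k, g)" "b = abs_lemono (k, h)" "c = abs_lemono (k, e)"
proof -
  obtain i g h where ab: "a = abs_lemono (i, g)" "b = abs_lemono (i, h)" by (rule lemono_rep2)
  obtain j e where c: "c = abs_lemono (j, e)" by (rule lemono_rep)
  show thesis using that[of "j + i" "(up ^^ j) g" "(up ^^ j) h" "(up ^^ i) e"]
    abs_lemono_shift[of i g j] abs_lemono_shift[of i h j] abs_lemono_shift[of j e i] ab c by (simp add: add.commute)
qed

instantiation lemono :: linordered_ab_group_add
begin

lift_definition zero_lemono :: lemono is "(0, 0)" .
lift_definition plus_lemono :: "lemono \<Rightarrow> lemono \<Rightarrow> lemono"
  is "\<lambda>(k, g) (l, h). (k + l, (up ^^ l) g + (up ^^ k) h)"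
proof -
  fix p p' q q' assume "same_lemono p p'" "same_lemono q q'"
  moreover obtain k g k' g' l h l' h' where p: "p = (k, g)" "p' = (k', g')" "q = (l, h)" "q' = (l', h')"
    by (cases p, cases p', cases q, cases q')
  ultimately have e: "(up ^^ k') g = (up ^^ k) g'" "(up ^^ l') h = (up ^^ l) h'" by (auto simp: same_lemono_def)
  have "(up ^^ (k' + l' + l)) g = (up ^^ (l' + l)) ((up ^^ k') g)"
    by (simp add: upn_upn add_ac)
  also have "\<dots> = (up ^^ (k + l + l')) g'" by (simp add: e upn_upn add_ac)
  finally have 1: "(up ^^ (k' + l' + l)) g = (up ^^ (k + l + l')) g'" .
  have "(up ^^ (k' + l' + k)) h = (up ^^ (k' + k)) ((up ^^ l') h)"
    by (simp add: upn_upn add_ac)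
  also have "\<dots> = (up ^^ (k + l + k')) h'" by (simp add: e upn_upn add_ac)
  finally have 2: "(up ^^ (k' + l' + k)) h = (up ^^ (k + l + k')) h'" .
  show "same_lemono ((case p of (k, g) \<Rightarrow> \<lambda>(l, h). (k + l, (up ^^ l) g + (up ^^ k) h)) q)
      ((case p' of (k, g) \<Rightarrow> \<lambda>(l, h). (k + l, (up ^^ l) g + (up ^^ k) h)) q')"
    using 1 2 by (simp add: p same_lemono_def upn_add upn_upn)
qed
lift_definition uminus_lemono :: "lemono \<Rightarrow> lemono" is "\<lambda>(k, g). (k, - g)"
  by (auto simp: same_lemono_def upn_uminus)
definition minus_lemono :: "lemono \<Rightarrow> lemono \<Rightarrow> lemono" where "minus_lemono g h = g + - h"
lift_definition less_lemono :: "lemono \<Rightarrow> lemono \<Rightarrow> bool" is "\<lambda>(k, g) (l, h). (up ^^ l) g < (up ^^ k) h"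
proof -
  fix p p' q q' assume "same_lemono p p'" "same_lemono q q'"
  moreover obtain k g k' g' l h l' h' where p: "p = (k, g)" "p' = (k', g')" "q = (l, h)" "q' = (l', h')"
    by (cases p, cases p', cases q, cases q')
  ultimately have e: "(up ^^ k') g = (up ^^ k) g'" "(up ^^ l') h = (up ^^ l) h'" by (auto simp: same_lemono_def)
  have "(up ^^ l) g < (up ^^ k) h \<longleftrightarrow> (up ^^ (k' + l' + l)) g < (up ^^ (k' + l' + k)) h"
    by (rule upn_cancel)
  also have "(up ^^ (k' + l' + l)) g = (up ^^ (l' + l)) ((up ^^ k') g)"
    by (simp add: upn_upn add_ac)
  also have "\<dots> = (up ^^ (k + l + l')) g'" by (simp add: e upn_upn add_ac)
  also have "(up ^^ (k' + l' + k)) h = (up ^^ (k' + k)) ((up ^^ l') h)"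
    by (simp add: upn_upn add_ac)
  also have "\<dots> = (up ^^ (k + l + k')) h'" by (simp add: e upn_upn add_ac)
  also have "(up ^^ (k + l + l')) g' < (up ^^ (k + l + k')) h' \<longleftrightarrow> (up ^^ l') g' < (up ^^ k') h'"
    by (rule upn_cancel[symmetric])
  finally show "(case p of (k, g) \<Rightarrow> \<lambda>(l, h). (up ^^ l) g < (up ^^ k) h) q =
      (case p' of (k, g) \<Rightarrow> \<lambda>(l, h). (up ^^ l) g < (up ^^ k) h) q'"
    by (simp add: p)
qed
definition less_eq_lemono :: "lemono \<Rightarrow> lemono \<Rightarrow> bool" where "less_eq_lemono g h \<longleftrightarrow> g = h \<or> g < h"

lemma at_add: "abs_lemono (k, g) + abs_lemono (k, h) = abs_lemono (k, g + h)"
  by (simp add: plus_lemono.abs_eq abs_lemono_eq upn_add upn_upn)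

lemma at_less: "abs_lemono (k, g) < abs_lemono (k, h) \<longleftrightarrow> g < h"
  by (simp add: less_lemono.abs_eq upn_less)

lemma at_uminus: "- abs_lemono (k, g) = abs_lemono (k, - g)"
  by (simp add: uminus_lemono.abs_eq)

lemma at_zero: "0 = abs_lemono (k, 0)"
  by (simp add: zero_lemono.abs_eq abs_lemono_eq upn_zero)

lemma at_eq: "abs_lemono (k, g) = abs_lemono (k, h) \<longleftrightarrow> g = h"
  by (simp add: abs_lemono_eq upn_inj)

instance
proof
  fix a b c :: lemono
  obtain k g h e where abc: "a = abs_lemono (k, g)" "b = abs_lemono (k, h)" "c = abs_lemono (k, e)"
    by (rule lemono_rep3)
  note s = abc at_add at_less at_uminus at_zero[of k] at_eq less_eq_lemono_def
  show "a + b + c = a + (b + c)" by (simp add: s algebra_simps)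
  show "a + b = b + a" by (simp add: s algebra_simps)
  show "0 + a = a" by (simp add: s)
  show "- a + a = 0" by (simp add: s)
  show "a - b = a + - b" by (rule minus_lemono_def)
  show "a \<le> a" by (simp add: less_eq_lemono_def)
  show "(a < b) = (a \<le> b \<and> \<not> b \<le> a)" by (auto simp: s)
  show "a \<le> b \<Longrightarrow> b \<le> c \<Longrightarrow> a \<le> c" by (auto simp: s)
  show "a \<le> b \<Longrightarrow> b \<le> a \<Longrightarrow> a = b" by (auto simp: s)
  show "a \<le> b \<or> b \<le> a" by (auto simp: s)
  show "a \<le> b \<Longrightarrow> c + a \<le> c + b" by (auto simp: s)
qed

end

definition lemonos :: "nat \<Rightarrow> nat \<Rightarrow> lemono set" where
  "lemonos k n = {abs_lemono (k, g) |g. g \<in> emonos n}"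

lemma LG_mono: "n \<le> m \<Longrightarrow> lemonos k n \<subseteq> lemonos (j + k) (m + j)"
proof
  fix a assume nm: "n \<le> m" and "a \<in> lemonos k n"
  then obtain g where g: "g \<in> emonos m" "a = abs_lemono (k, g)" using G_mono unfolding lemonos_def by blast
  then show "a \<in> lemonos (j + k) (m + j)"
    using upn_G[OF g(1), of j] abs_lemono_shift[of k g j] unfolding lemonos_def by auto
qed

lemma LG_directed: "\<exists>j m. lemonos k n \<union> lemonos k' n' \<subseteq> lemonos j m"
proof -
  have "lemonos k n \<subseteq> lemonos (k' + k) (n + n' + k + k')"
    using LG_mono[of n "n + n' + k" k k'] by auto
  moreover have "lemonos k' n' \<subseteq> lemonos (k + k') (n + n' + k' + k)"
    using LG_mono[of n' "n + n' + k'" k' k] by auto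
  ultimately show ?thesis by (metis Un_least add.commute add.assoc)
qed

lemma LG_add: "a \<in> lemonos k n \<Longrightarrow> b \<in> lemonos k n \<Longrightarrow> a + b \<in> lemonos k n"
  using G_add by (auto simp: lemonos_def at_add)

lemma slin_linorder: "slin (<) (S :: 'a::linorder set)"
  by (auto simp: slin_def irreflp_on_def transp_on_def totalp_on_def)

lemma wo_rwo_finite:
  fixes F :: "'a::linorder set"
  assumes r: "rwo (<) F" and w: "rwo (>) F"
  shows "finite F"
proof (cases "\<forall>a\<in>F. finite {x\<in>F. x \<le> a}")
  case True
  show ?thesis
  proof (cases "F = {}")
    case False
    then obtain m where m: "m \<in> F" "\<And>a. a \<in> F \<Longrightarrow> a = m \<or> a < m" using rwoE[OF r order_refl] by auto
    then have "F = {x\<in>F. x \<le> m}" by force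
    then show ?thesis using True m(1) by auto
  qed simp
next
  case False
  define P where "P = {a\<in>F. infinite {x\<in>F. x \<le> a}}"
  have "P \<subseteq> F" "P \<noteq> {}" using False by (auto simp: P_def)
  then obtain p where p: "p \<in> P" "\<And>a. a \<in> P \<Longrightarrow> a = p \<or> a > p" using rwoE[OF w] by metis
  define Q where "Q = {x\<in>F. x < p}"
  have fp: "{x\<in>F. x \<le> p} = insert p Q" using p(1) by (auto simp: P_def Q_def)
  have "finite Q"
  proof (cases "Q = {}")
    case False
    have "Q \<subseteq> F" by (auto simp: Q_def)
    then obtain q where q: "q \<in> Q" "\<And>a. a \<in> Q \<Longrightarrow> a = q \<or> a < q" using rwoE[OF r _ False] by auto
    have "q \<notin> P" using p(2)[of q] q(1) by (auto simp: Q_def)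
    then have "finite {x\<in>F. x \<le> q}" using q(1) by (auto simp: P_def Q_def)
    moreover have "Q \<subseteq> {x\<in>F. x \<le> q}" using q(2) by (force simp: Q_def)
    ultimately show ?thesis by (rule rev_finite_subset)
  qed simp
  then show ?thesis using p(1) fp by (auto simp: P_def)
qed

lemma rwo_fibre_finite:
  fixes A B :: "'a::linordered_ab_group_add set"
  assumes "rwo (<) A" "rwo (<) B"
  shows "finite {a\<in>A. m - a \<in> B}"
proof (rule wo_rwo_finite)
  show "rwo (<) {a\<in>A. m - a \<in> B}" by (rule rwo_subset[OF assms(1)]) auto
  have "rwo (>) ((\<lambda>b. m - b) ` B)" by (rule rwo_image[OF assms(2)]) auto
  then show "rwo (>) {a\<in>A. m - a \<in> B}"
  proof (rule rwo_subset)
    show "{a\<in>A. m - a \<in> B} \<subseteq> (\<lambda>b. m - b) ` B"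
    proof
      fix a assume "a \<in> {a\<in>A. m - a \<in> B}"
      then have "m - a \<in> B" "a = m - (m - a)" by auto
      then show "a \<in> (\<lambda>b. m - b) ` B" by (rule rev_image_eqI)
    qed
  qed
qed

lemma rwo_sum:
  fixes A B :: "'a::linordered_ab_group_add set"
  assumes A: "rwo (<) A" and B: "rwo (<) B"
  shows "rwo (<) {a + b |a b. a \<in> A \<and> b \<in> B}"
  unfolding rwo_def
proof (intro allI impI, rule ccontr)
  fix C assume C: "C \<subseteq> {a + b |a b. a \<in> A \<and> b \<in> B}" "C \<noteq> {}"
    and no: "\<not> (\<exists>m\<in>C. \<forall>a\<in>C. a = m \<or> a < m)"
  have step: "\<exists>y\<in>C. x < y" if "x \<in> C" for x
    using no that by (meson linorder_less_linear)
  obtain c where c: "\<And>n. c n \<in> C" "\<And>n. c n < c (Suc n)"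
    using dependent_nat_choice[of "\<lambda>_ x. x \<in> C" "\<lambda>_ x y. x < y"] C(2) step by blast
  have "\<exists>a b. c n = a + b \<and> a \<in> A \<and> b \<in> B" for n using c(1)[of n] C(1) by auto
  then obtain a b where ab: "\<And>n. c n = a n + b n" "\<And>n. a n \<in> A" "\<And>n. b n \<in> B" by metis
  obtain f where f: "strict_mono f" "monoseq (\<lambda>n. a (f n))" using seq_monosub by blast
  have cmono: "c (f i) < c (f j)" if "i < j" for i j
    using strict_monoD[OF f(1) that] c(2) by (simp add: lift_Suc_mono_less)
  have "\<exists>N. \<forall>i\<ge>N. \<forall>j\<ge>i. a (f j) \<le> a (f i)"
  proof (cases "\<forall>m n. m \<le> n \<longrightarrow> a (f n) \<le> a (f m)")
    case False
    then have up: "a (f m) \<le> a (f n)" if "m \<le> n" for m n using f(2) that unfolding monoseq_def by blast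
    have "range (\<lambda>n. a (f n)) \<subseteq> A" using ab(2) by auto
    from rwoE[OF A this] obtain M
      where M: "M \<in> range (\<lambda>n. a (f n))" "\<And>x. x \<in> range (\<lambda>n. a (f n)) \<Longrightarrow> x = M \<or> x < M" by auto
    obtain N where "M = a (f N)" using M(1) by auto
    then have N: "a (f x) \<le> a (f N)" for x using M(2)[of "a (f x)"] by auto
    have "a (f j) \<le> a (f i)" if "i \<ge> N" for i j using N[of j] up[OF that] by simp
    then show ?thesis by blast
  qed blast
  then obtain N where N: "\<And>i j. N \<le> i \<Longrightarrow> i \<le> j \<Longrightarrow> a (f j) \<le> a (f i)" by blast
  have bmono: "b (f i) < b (f j)" if "N \<le> i" "i < j" for i j
  proof (rule ccontr)
    assume "\<not> ?thesis"
    then have "a (f j) + b (f j) \<le> a (f i) + b (f i)"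
      using N[OF that(1), of j] that(2) by (intro add_mono) auto
    then show False using cmono[OF that(2)] ab(1) by simp
  qed
  have "(\<lambda>n. b (f n)) ` {N..} \<subseteq> B" using ab(3) by auto
  moreover have "(\<lambda>n. b (f n)) ` {N..} \<noteq> {}" by auto
  ultimately obtain M
    where M: "M \<in> (\<lambda>n. b (f n)) ` {N..}" "\<And>x. x \<in> (\<lambda>n. b (f n)) ` {N..} \<Longrightarrow> x = M \<or> x < M"
    using rwoE[OF B] by metis
  obtain K where K: "K \<ge> N" "M = b (f K)" using M(1) by auto
  have "b (f (Suc K)) \<in> (\<lambda>n. b (f n)) ` {N..}" using K(1) by (intro imageI) auto
  then show False using M(2)[of "b (f (Suc K))"] bmono[OF K(1), of "Suc K"] K(2) by auto
qed

definition hahn_mult :: "('a::ab_group_add \<Rightarrow> real) \<Rightarrow> ('a \<Rightarrow> real) \<Rightarrow> 'a \<Rightarrow> real" where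
  "hahn_mult f g m = (\<Sum>a\<in>{a\<in>supp f. m - a \<in> supp g}. f a * g (m - a))"

lemma hahn_mult_closed:
  fixes S :: "'a::linordered_ab_group_add set"
  assumes "\<And>a b. a \<in> S \<Longrightarrow> b \<in> S \<Longrightarrow> a + b \<in> S" and f: "f \<in> hahn (<) S" and g: "g \<in> hahn (<) S"
  shows "hahn_mult f g \<in> hahn (<) S"
proof -
  let ?C = "{a + b |a b. a \<in> supp f \<and> b \<in> supp g}"
  have "supp (hahn_mult f g) \<subseteq> ?C"
  proof
    fix m assume "m \<in> supp (hahn_mult f g)"
    then have "hahn_mult f g m \<noteq> 0" by (simp add: supp_def)
    then have "{a\<in>supp f. m - a \<in> supp g} \<noteq> {}" unfolding hahn_mult_def by (metis sum.empty)
    then obtain a where "a \<in> supp f" "m - a \<in> supp g" by auto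
    moreover have "m = a + (m - a)" by simp
    ultimately show "m \<in> ?C" by blast
  qed
  moreover have "rwo (<) ?C" using f g by (intro rwo_sum) (auto simp: hahn_def)
  moreover have "?C \<subseteq> S"
  proof
    fix m assume "m \<in> ?C"
    then obtain a b where ab: "m = a + b" "a \<in> supp f" "b \<in> supp g" by auto
    have "a \<in> S" "b \<in> S" using ab f g unfolding hahn_def by auto
    then show "m \<in> S" unfolding ab(1) by (rule assms(1))
  qed
  ultimately show ?thesis unfolding hahn_def using rwo_subset[of "(<)" ?C] order_trans[of _ ?C S] by simp
qed

text \<open>\<open>\<T>\<close> is the direct limit of the fields \<open>\<Union>n. \<real>((G\<^sub>n))\<close> along the substitution \<open>x \<mapsto> exp x\<close>. As a
  subset of \<open>\<real>((lemono))\<close> it consists of the series whose monomials have bounded exponential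
  and logarithmic depth.\<close>

typedef transseries = "{f :: lemono \<Rightarrow> real. \<exists>k n. f \<in> hahn (<) (lemonos k n)}" morphisms coeff Abs_transseries
  using hahn_zero by blast

setup_lifting type_definition_transseries

lemma hahn_LG2:
  assumes "\<exists>k n. f \<in> hahn (<) (lemonos k n)" "\<exists>k n. g \<in> hahn (<) (lemonos k n)"
  obtains k n where "f \<in> hahn (<) (lemonos k n)" "g \<in> hahn (<) (lemonos k n)"
proof -
  obtain k n k' n' where fg: "f \<in> hahn (<) (lemonos k n)" "g \<in> hahn (<) (lemonos k' n')" using assms by auto
  obtain j m where "lemonos k n \<union> lemonos k' n' \<subseteq> lemonos j m" using LG_directed by blast
  then have "hahn (<) (lemonos k n) \<subseteq> hahn (<) (lemonos j m)" "hahn (<) (lemonos k' n') \<subseteq> hahn (<) (lemonos j m)"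
    by (auto intro!: hahn_mono)
  then show thesis using fg that by blast
qed

lemma hahn_UNIV: "\<exists>k n. f \<in> hahn (<) (lemonos k n) \<Longrightarrow> f \<in> hahn (<) UNIV"
  by (auto simp: hahn_def)

instantiation transseries :: linordered_ab_group_add
begin

lift_definition zero_transseries :: transseries is "\<lambda>_. 0" using hahn_zero by blast
lift_definition plus_transseries :: "transseries \<Rightarrow> transseries \<Rightarrow> transseries" is "\<lambda>f g m. f m + g m"
proof -
  fix f g :: "lemono \<Rightarrow> real"
  assume "\<exists>k n. f \<in> hahn (<) (lemonos k n)" "\<exists>k n. g \<in> hahn (<) (lemonos k n)"
  then obtain k n where "f \<in> hahn (<) (lemonos k n)" "g \<in> hahn (<) (lemonos k n)" by (rule hahn_LG2)
  then have "(\<lambda>m. f m + g m) \<in> hahn (<) (lemonos k n)" by (rule hahn_add[OF slin_linorder])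
  then show "\<exists>k n. (\<lambda>m. f m + g m) \<in> hahn (<) (lemonos k n)" by blast
qed
lift_definition uminus_transseries :: "transseries \<Rightarrow> transseries" is "\<lambda>f m. - f m"
  by (blast intro: hahn_uminus)
definition minus_transseries :: "transseries \<Rightarrow> transseries \<Rightarrow> transseries" where
  "minus_transseries f g = f + - g"
lift_definition less_transseries :: "transseries \<Rightarrow> transseries \<Rightarrow> bool" is "series_less (<)" .
definition less_eq_transseries :: "transseries \<Rightarrow> transseries \<Rightarrow> bool" where
  "less_eq_transseries f g \<longleftrightarrow> f = g \<or> f < g"

instance
proof
  have L: "slin (series_less (<)) (hahn (<) (UNIV :: lemono set))" by (rule slin_hahn[OF slin_linorder])
  have irr: "\<not> a < a" for a :: transseries by transfer (auto simp: series_less_def)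
  have tr: "a < b \<Longrightarrow> b < c \<Longrightarrow> a < c" for a b c :: transseries
    by transfer (rule slin_trans[OF L hahn_UNIV hahn_UNIV hahn_UNIV])
  have tot: "a = b \<or> a < b \<or> b < a" for a b :: transseries
    by transfer (use slin_total[OF L hahn_UNIV hahn_UNIV] in blast)
  have mono: "a < b \<Longrightarrow> c + a < c + b" for a b c :: transseries by transfer (simp add: series_less_def)
  fix a b c :: transseries
  show "a + b + c = a + (b + c)" by transfer (simp add: add.assoc)
  show "a + b = b + a" by transfer (simp add: add.commute)
  show "0 + a = a" by transfer simp
  show "- a + a = 0" by transfer simp
  show "a - b = a + - b" by (rule minus_transseries_def)
  show "a \<le> a" by (simp add: less_eq_transseries_def)
  show "(a < b) = (a \<le> b \<and> \<not> b \<le> a)" unfolding less_eq_transseries_def using irr tr[of a b a] by auto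
  show "a \<le> b \<Longrightarrow> b \<le> c \<Longrightarrow> a \<le> c" unfolding less_eq_transseries_def using tr[of a b c] by auto
  show "a \<le> b \<Longrightarrow> b \<le> a \<Longrightarrow> a = b" unfolding less_eq_transseries_def using irr[of a] tr[of a b a] by auto
  show "a \<le> b \<or> b \<le> a" unfolding less_eq_transseries_def using tot[of a b] by auto
  show "a \<le> b \<Longrightarrow> c + a \<le> c + b" unfolding less_eq_transseries_def using mono[of a b c] by auto
qed

end

definition monomial :: "lemono \<Rightarrow> transseries" where
  "monomial g = Abs_transseries (\<lambda>m. if m = g then 1 else 0)"

lemma coeff_monomial: "coeff (monomial g) = (\<lambda>m. if m = g then 1 else 0)"
proof -
  obtain k h where g: "g = abs_lemono (k, h)" by (rule lemono_rep)
  obtain n where "h \<in> emonos n" using rep_emono[of h] unfolding emonos_def pre_emono_def by auto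
  then have "(\<lambda>m. if m = g then 1 else 0) \<in> hahn (<) (lemonos k n)"
    unfolding lemonos_def by (auto simp: hahn_def supp_def rwo_def g)
  then show ?thesis unfolding monomial_def by (intro Abs_transseries_inverse) blast
qed

instantiation transseries :: "{one, times}"
begin

lift_definition times_transseries :: "transseries \<Rightarrow> transseries \<Rightarrow> transseries" is hahn_mult
proof -
  fix f g :: "lemono \<Rightarrow> real"
  assume "\<exists>k n. f \<in> hahn (<) (lemonos k n)" "\<exists>k n. g \<in> hahn (<) (lemonos k n)"
  then obtain k n where "f \<in> hahn (<) (lemonos k n)" "g \<in> hahn (<) (lemonos k n)" by (rule hahn_LG2)
  then have "hahn_mult f g \<in> hahn (<) (lemonos k n)" by (intro hahn_mult_closed LG_add)
  then show "\<exists>k n. hahn_mult f g \<in> hahn (<) (lemonos k n)" by blast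
qed

definition one_transseries :: transseries where
  "one_transseries = monomial 0"

instance ..

end

definition transmonomials :: "transseries set" where
  "transmonomials = range monomial"

lemma monomial_zero: "monomial 0 = 1"
  by (simp add: one_transseries_def)

lemma monomial_add: "monomial (g + h) = monomial g * monomial h"
proof -
  have "coeff (monomial (g + h)) m = coeff (monomial g * monomial h) m" for m
  proof -
    have "{a\<in>supp (coeff (monomial g)). m - a \<in> supp (coeff (monomial h))} = (if m = g + h then {g} else {})"
      by (auto simp: supp_def coeff_monomial algebra_simps)
    then show ?thesis
      by (simp add: times_transseries.rep_eq hahn_mult_def) (simp add: coeff_monomial)
  qed
  then show ?thesis by (simp add: coeff_inject[symmetric] fun_eq_iff)
qed

lemma monomial_pos: "0 < monomial g"
  unfolding less_transseries.rep_eq coeff_monomial zero_transseries.rep_eq series_less_def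
  by (intro exI[of _ g]) auto

lemma monomial_less: "monomial g < monomial h \<longleftrightarrow> g < h"
proof -
  have "monomial g < monomial h" if "g < h" for g h
    unfolding less_transseries.rep_eq coeff_monomial series_less_def
    using that by (intro exI[of _ h]) auto
  from this[of g h] this[of h g] show ?thesis by (cases g h rule: linorder_cases) auto
qed

end

theory Submission
  imports Defs
begin

text \<open>The logarithm identifies the ordered group of transmonomials with the additive group of the
  purely infinite transseries, i.e. those supported on the set of monomials \<open>> 1\<close>. It remains to find
  an order isomorphism between the set of all monomials and the set of the monomials \<open>> 1\<close> under
  which sets of bounded exponential and logarithmic depth correspond to each other: relabelling the
  monomials then turns \<open>\<T>\<close> into the purely infinite series.

  Write \<open>e\<^sub>n\<close> for the \<open>n\<close>-fold exponential and \<open>l\<^sub>n\<close> for the \<open>n\<close>-fold logarithm of \<open>x\<close>. The \<open>1 / e\<^sub>n\<close> are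
  coinitial among all monomials, the \<open>l\<^sub>n\<close> among the monomials \<open>> 1\<close>. The interval from \<open>1 / e\<^sub>n\<^sub>+\<^sub>1\<close> to
  \<open>1 / e\<^sub>n\<close> is mapped onto the interval from \<open>l\<^sub>n\<^sub>+\<^sub>1\<close> to \<open>l\<^sub>n\<close> by translations and the \<open>(2n+1)\<close>-fold
  substitution \<open>x \<mapsto> log x\<close>, which takes \<open>e\<^sub>n\<^sub>+\<^sub>1 / e\<^sub>n\<close> to \<open>l\<^sub>n / l\<^sub>n\<^sub>+\<^sub>1\<close>; above \<open>1 / e\<^sub>0\<close> a translation
  suffices. A set of bounded depth meets only finitely many of these intervals.\<close>

section \<open>Exponential monomials\<close>

definition xpow :: "emono \<Rightarrow> real" where
  "xpow g = pxpow (rep_emono g)"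

text \<open>For \<open>g\<close> = x^b exp(f) this is f, indexed by \<open>emono\<close> in place of
  \<open>pre\<close>. No term is lost, since f is supported in \<open>pre_emono\<close>.\<close>

definition expo :: "emono \<Rightarrow> emono \<Rightarrow> real" where
  "expo g h = pexpo (rep_emono g) (rep_emono h)"

lift_definition var :: emono is px
  by (rule pG_pE[OF pmon0_in])

lemma pexpo_supp_pre_emono:
  assumes "g \<in> pre_emono" "pexpo g m \<noteq> 0"
  shows "m \<in> pre_emono"
proof -
  obtain n where "g \<in> pre_emonos (Suc n)"
    using pE_SucE[OF assms(1) assms(1) assms(1)] by blast
  then show ?thesis
    using pG_SucD(1)[of g n] assms(2) pG_pE[of m n] by (auto simp: hahn_def supp_def)
qed

lemma pexpo_supp_rep_emono:
  assumes "pexpo (rep_emono g) m \<noteq> 0"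
  shows "\<exists>h. m = rep_emono h"
  using pexpo_supp_pre_emono[OF rep_emono assms] by (metis Abs_emono_inverse)

lemma expo_eq_iff: "expo g = expo h \<longleftrightarrow> pexpo (rep_emono g) = pexpo (rep_emono h)"
proof
  assume eq: "expo g = expo h"
  show "pexpo (rep_emono g) = pexpo (rep_emono h)"
  proof
    fix m
    show "pexpo (rep_emono g) m = pexpo (rep_emono h) m"
    proof (cases "m \<in> pre_emono")
      case True
      then show ?thesis
        using fun_cong[OF eq, of "Abs_emono m"] by (simp add: expo_def Abs_emono_inverse)
    next
      case False
      then show ?thesis
        using pexpo_supp_pre_emono[OF rep_emono] by metis
    qed
  qed
qed (simp add: expo_def fun_eq_iff)

text \<open>Monomials at which two exponents differ lie in one of the supports, hence in the range
  of \<open>rep_emono\<close>; the junk elements of \<open>pre\<close> cannot affect the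
  comparison.\<close>

lemma series_less_expo_iff:
  "series_less (<) (expo g) (expo h) \<longleftrightarrow> series_less pless (pexpo (rep_emono g)) (pexpo (rep_emono h))"
    (is "?l \<longleftrightarrow> ?r")
proof
  assume ?l
  then obtain m where m: "expo g m < expo h m" "\<And>m'. expo g m' \<noteq> expo h m' \<Longrightarrow> m' = m \<or> m' < m"
    unfolding series_less_def by blast
  have "y = rep_emono m \<or> pless y (rep_emono m)" if "pexpo (rep_emono g) y \<noteq> pexpo (rep_emono h) y" for y
  proof -
    have "pexpo (rep_emono g) y \<noteq> 0 \<or> pexpo (rep_emono h) y \<noteq> 0"
      using that by auto
    then obtain m' where "y = rep_emono m'"
      using pexpo_supp_rep_emono by blast
    then show ?thesis
      using m(2)[of m'] that by (auto simp: expo_def less_emono.rep_eq)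
  qed
  then show ?r
    using m(1) unfolding series_less_def expo_def by blast
next
  assume ?r
  then obtain y where y: "pexpo (rep_emono g) y < pexpo (rep_emono h) y"
    "\<And>x. pexpo (rep_emono g) x \<noteq> pexpo (rep_emono h) x \<Longrightarrow> x = y \<or> pless x y"
    unfolding series_less_def by blast
  have "pexpo (rep_emono g) y \<noteq> 0 \<or> pexpo (rep_emono h) y \<noteq> 0"
    using y(1) by auto
  then obtain m where m: "y = rep_emono m"
    using pexpo_supp_rep_emono by blast
  have "m' = m \<or> m' < m" if "expo g m' \<noteq> expo h m'" for m'
    using y(2)[of "rep_emono m'"] that m by (auto simp: expo_def less_emono.rep_eq rep_emono_inject)
  then show ?l
    using y(1) m unfolding series_less_def expo_def by blast
qed

lemma emono_less_iff:
  "g < h \<longleftrightarrow> expo g = expo h \<and> xpow g < xpow h \<or> series_less (<) (expo g) (expo h)"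
  unfolding less_emono.rep_eq expo_eq_iff series_less_expo_iff xpow_def by (rule pless_iff)

lemma expo_hahn:
  assumes "g \<in> emonos (Suc n)"
  shows "expo g \<in> hahn (<) (emonos n)"
proof -
  have H: "pexpo (rep_emono g) \<in> hahn pless (pre_emonos n)"
    using pG_SucD(1) assms by (simp add: emonos_def)
  have "supp (expo g) = Abs_emono ` supp (pexpo (rep_emono g))"
  proof (intro set_eqI iffI)
    fix m assume "m \<in> supp (expo g)"
    then show "m \<in> Abs_emono ` supp (pexpo (rep_emono g))"
      by (intro image_eqI[of _ _ "rep_emono m"]) (auto simp: supp_def expo_def rep_emono_inverse)
  next
    fix m assume "m \<in> Abs_emono ` supp (pexpo (rep_emono g))"
    then show "m \<in> supp (expo g)"
      using pexpo_supp_pre_emono[OF rep_emono] by (auto simp: supp_def expo_def Abs_emono_inverse)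
  qed
  moreover have "rwo (<) (Abs_emono ` supp (pexpo (rep_emono g)))"
  proof (rule rwo_image)
    show "rwo pless (supp (pexpo (rep_emono g)))"
      using H by (simp add: hahn_def)
  qed (use pexpo_supp_pre_emono[OF rep_emono] in \<open>auto simp: supp_def less_emono.rep_eq Abs_emono_inverse\<close>)
  moreover have "supp (expo g) \<subseteq> emonos n"
    using H by (auto simp: hahn_def supp_def expo_def emonos_def)
  ultimately show ?thesis
    by (simp add: hahn_def)
qed

lemma emono_level: obtains n where "g \<in> emonos (Suc n)"
proof -
  obtain n where "rep_emono g \<in> pre_emonos (Suc n)"
    using pE_SucE[OF rep_emono rep_emono rep_emono] by blast
  then show thesis
    using that by (simp add: emonos_def)
qed

lemma expo_supp_pos:
  assumes "expo g h \<noteq> 0"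
  shows "0 < h"
proof -
  obtain n where "rep_emono g \<in> pre_emonos (Suc n)"
    using emono_level[of g] by (auto simp: emonos_def)
  then show ?thesis
    using pG_SucD(2) assms by (simp add: less_emono.rep_eq zero_emono.rep_eq supp_def expo_def)
qed

lemma expo_surj:
  assumes f: "f \<in> hahn (<) (emonos n)" and pos: "\<And>m. f m \<noteq> 0 \<Longrightarrow> 0 < m"
  obtains g where "g \<in> emonos (Suc n)" "xpow g = b" "expo g = f"
proof -
  \<comment> \<open>The series is extended by 0 to the junk elements of \<open>pre\<close>.\<close>
  define F where "F m = (if m \<in> pre_emono then f (Abs_emono m) else 0)" for m
  have supp_F: "supp F = rep_emono ` supp f"
  proof (intro set_eqI iffI)
    fix m assume "m \<in> supp F"
    then show "m \<in> rep_emono ` supp f"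
      by (intro image_eqI[of _ _ "Abs_emono m"]) (auto simp: supp_def F_def Abs_emono_inverse split: if_splits)
  qed (use rep_emono in \<open>auto simp: supp_def F_def rep_emono_inverse\<close>)
  have "rwo pless (rep_emono ` supp f)"
    by (rule rwo_image[of "(<)"]) (use f in \<open>auto simp: hahn_def less_emono.rep_eq\<close>)
  then have F: "F \<in> hahn pless (pre_emonos n)"
    using f by (auto simp: hahn_def supp_F emonos_def)
  have "pless pone m" if "m \<in> supp F" for m
    using that pos unfolding supp_F by (auto simp: less_emono.rep_eq zero_emono.rep_eq supp_def)
  then have g: "pmon b F \<in> pre_emonos (Suc n)"
    by (rule pG_SucI[OF F])
  then have rep: "rep_emono (Abs_emono (pmon b F)) = pmon b F"
    by (simp add: Abs_emono_inverse pG_pE)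
  show thesis
  proof (rule that)
    show "Abs_emono (pmon b F) \<in> emonos (Suc n)"
      using g by (simp add: emonos_def rep)
    show "xpow (Abs_emono (pmon b F)) = b"
      by (simp add: xpow_def rep)
    show "expo (Abs_emono (pmon b F)) = f"
      using rep_emono
      by (simp add: fun_eq_iff expo_def rep pexpo_pmon[OF countable_supp_hahn[OF F]] F_def rep_emono_inverse)
  qed
qed

lemma expo_add: "expo (g + h) m = expo g m + expo h m"
  by (simp add: expo_def plus_emono.rep_eq pexpo_pmul rep_emono)

section \<open>Exponents under the substitution x -> exp x\<close>

lemma xpow_up [simp]: "xpow (up g) = 0"
  by (simp add: xpow_def up.rep_eq)

lemma xpow_zero [simp]: "xpow 0 = 0"
  by (simp add: xpow_def zero_emono.rep_eq)

lemma expo_zero [simp]: "expo 0 = (\<lambda>_. 0)"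
  by (simp add: expo_def zero_emono.rep_eq fun_eq_iff)

lemma xpow_var [simp]: "xpow var = 1"
  by (simp add: xpow_def var.rep_eq)

lemma expo_var [simp]: "expo var = (\<lambda>_. 0)"
  by (simp add: expo_def var.rep_eq fun_eq_iff)

lemma expo_up_up [simp]: "expo (up g) (up h) = expo g h"
  by (simp add: expo_def up.rep_eq pexpo_pup)

lemma expo_up_var [simp]: "expo (up g) var = xpow g"
  by (simp add: expo_def xpow_def var.rep_eq up.rep_eq pexpo_pup)

lemma expo_up_cases:
  assumes "expo (up g) m \<noteq> 0"
  obtains "m = var" "xpow g \<noteq> 0" | h where "m = up h" "expo g h \<noteq> 0"
proof (cases "rep_emono m" rule: pre_cases)
  case 1
  then have "m = var"
    by (simp add: rep_emono_inject[symmetric] var.rep_eq)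
  then show thesis
    using that(1) assms by simp
next
  case (2 y)
  then have y: "pexpo (rep_emono g) y \<noteq> 0"
    using assms by (simp add: expo_def up.rep_eq pexpo_pup)
  then obtain h where h: "y = rep_emono h"
    using pexpo_supp_rep_emono by blast
  then have "m = up h"
    using 2 by (simp add: rep_emono_inject[symmetric] up.rep_eq)
  then show thesis
    using that(2) y h by (simp add: expo_def)
next
  case 3
  then show thesis
    using assms by (simp add: expo_def up.rep_eq pexpo_pup)
qed

lemma expo_upn_upn: "expo ((up ^^ k) g) ((up ^^ k) h) = expo g h"
  by (induction k) auto

text \<open>A factor x^b of \<open>g\<close> would become the term b * \<open>var\<close> of the new
  exponent, and \<open>var\<close> is not in the range of \<open>up\<close>. The hypothesis
  \<open>xpow g = 0\<close> excludes this at the first step, \<open>xpow_up\<close> at all later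
  ones.\<close>

lemma expo_upn_supp:
  "xpow g = 0 \<Longrightarrow> expo ((up ^^ k) g) m \<noteq> 0 \<Longrightarrow> \<exists>h. m = (up ^^ k) h \<and> expo g h \<noteq> 0"
proof (induction k arbitrary: m)
  case (Suc k)
  have "xpow ((up ^^ k) g) = 0"
    using Suc.prems(1) by (cases k) auto
  then obtain m' where "m = up m'" "expo ((up ^^ k) g) m' \<noteq> 0"
    using expo_up_cases[of "(up ^^ k) g" m] Suc.prems(2) by auto
  then show ?case
    using Suc.IH[OF Suc.prems(1)] by auto
qed simp

section \<open>Iterated exponentials as bounds\<close>

lemma var_pos: "0 < var"
  by (simp add: emono_less_iff)

text \<open>As \<open>up g\<close> is positive and has x-power 0, its exponent must be a positive
  series, and this outweighs any power of x.\<close>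

lemma var_less_up:
  assumes "0 < g"
  shows "var < up g"
  using up_less[OF assms] upn_zero[of 1] by (simp add: emono_less_iff)

lemma emonos_uminus: "g \<in> emonos n \<Longrightarrow> - g \<in> emonos n"
  by (simp add: emonos_def uminus_emono.rep_eq pinv_pG)

text \<open>Since \<open>(up ^^ n) var\<close> is the n-fold exponential e_n, this is the identity
  log e_(n+1) = e_n.\<close>

lemma expo_upn_var:
  "expo ((up ^^ Suc n) var) = (\<lambda>m. if m = (up ^^ n) var then 1 else 0)"
proof
  fix m
  have eq: "(up ^^ Suc n) var = (up ^^ n) (up var)"
    by (simp only: funpow_Suc_right o_apply)
  have "expo ((up ^^ n) (up var)) ((up ^^ n) var) = 1"
    by (simp add: expo_upn_upn)
  moreover have "m = (up ^^ n) var" if nz: "expo ((up ^^ n) (up var)) m \<noteq> 0"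
  proof -
    obtain h where h: "m = (up ^^ n) h" "expo (up var) h \<noteq> 0"
      using expo_upn_supp[OF xpow_up nz] by blast
    from h(2) have "h = var"
      by (rule expo_up_cases) simp_all
    then show ?thesis
      using h(1) by simp
  qed
  ultimately show "expo ((up ^^ Suc n) var) m = (if m = (up ^^ n) var then 1 else 0)"
    unfolding eq by metis
qed

text \<open>Induction through logarithms: the monomials in the exponent of \<open>g\<close> are one
  level lower, hence all below the single monomial in the exponent of the iterated
  exponential.\<close>

lemma emonos_less_upn_var: "g \<in> emonos n \<Longrightarrow> g < (up ^^ Suc n) var"
proof (induction n arbitrary: g)
  case 0
  then have "expo g = (\<lambda>_. 0)"
    by (auto simp: emonos_def expo_def fun_eq_iff)
  then have "series_less (<) (expo g) (expo ((up ^^ Suc 0) var))"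
    unfolding expo_upn_var series_less_def by (intro exI[of _ var]) auto
  then show ?case
    by (simp add: emono_less_iff)
next
  case (Suc n)
  have below: "m < (up ^^ Suc n) var" if "expo g m \<noteq> 0" for m
    using expo_hahn[OF Suc.prems] that by (intro Suc.IH) (auto simp: hahn_def supp_def)
  then have zero: "expo g ((up ^^ Suc n) var) = 0"
    using less_irrefl by metis
  have "series_less (<) (expo g) (expo ((up ^^ Suc (Suc n)) var))"
    unfolding expo_upn_var series_less_def
  proof (intro exI[of _ "(up ^^ Suc n) var"] conjI allI impI)
    fix m assume "expo g m \<noteq> (if m = (up ^^ Suc n) var then 1 else 0)"
    then show "m = (up ^^ Suc n) var \<or> m < (up ^^ Suc n) var"
      using below by metis
  qed (simp only: zero, simp)
  then show ?case
    by (intro emono_less_iff[THEN iffD2] disjI2)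
qed

section \<open>The logarithm of an LE-monomial\<close>

text \<open>\<open>log_coeff a m\<close> is the coefficient of \<open>m\<close> in \<open>log a\<close>. Both monomials are brought to the same
  logarithmic depth; one further \<open>up\<close> turns the power of \<open>x\<close> into an exponential, so that its
  contribution \<open>b log x\<close> is seen by \<open>expo\<close>.\<close>

lift_definition log_coeff :: "lemono \<Rightarrow> lemono \<Rightarrow> real"
  is "\<lambda>(k, g) (l, h). expo ((up ^^ Suc l) g) ((up ^^ Suc k) h)"
proof -
  fix p p' q q' assume "same_lemono p p'" "same_lemono q q'"
  moreover obtain k g k' g' l h l' h' where p: "p = (k, g)" "p' = (k', g')" "q = (l, h)" "q' = (l', h')"
    by (cases p, cases p', cases q, cases q')
  ultimately have e: "(up ^^ k') g = (up ^^ k) g'" "(up ^^ l') h = (up ^^ l) h'"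
    by (auto simp: same_lemono_def)
  \<comment> \<open>\<open>expo\<close> is invariant under applying the same power of
    \<open>up\<close> to both arguments; the powers are chosen so that the two equations
    \<open>e\<close> can be applied.\<close>
  have "expo ((up ^^ Suc l) g) ((up ^^ Suc k) h)
      = expo ((up ^^ (k' + l')) ((up ^^ Suc l) g)) ((up ^^ (k' + l')) ((up ^^ Suc k) h))"
    by (simp only: expo_upn_upn)
  also have "(up ^^ (k' + l')) ((up ^^ Suc l) g) = (up ^^ Suc (l' + l)) ((up ^^ k') g)"
    unfolding upn_upn by (simp add: add_ac)
  also have "\<dots> = (up ^^ (k + l)) ((up ^^ Suc l') g')"
    unfolding e upn_upn by (simp add: add_ac)
  also have "(up ^^ (k' + l')) ((up ^^ Suc k) h) = (up ^^ Suc (k' + k)) ((up ^^ l') h)"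
    unfolding upn_upn by (simp add: add_ac)
  also have "\<dots> = (up ^^ (k + l)) ((up ^^ Suc k') h')"
    unfolding e upn_upn by (simp add: add_ac)
  finally show "(case p of (k, g) \<Rightarrow> \<lambda>(l, h). expo ((up ^^ Suc l) g) ((up ^^ Suc k) h)) q =
      (case p' of (k, g) \<Rightarrow> \<lambda>(l, h). expo ((up ^^ Suc l) g) ((up ^^ Suc k) h)) q'"
    unfolding p prod.case expo_upn_upn .
qed

lemma log_coeff_same_depth: "log_coeff (abs_lemono (k, g)) (abs_lemono (k, h)) = expo g h"
  unfolding log_coeff.abs_eq prod.case by (rule expo_upn_upn)

lemma log_coeff_supp:
  assumes "xpow g = 0" "log_coeff (abs_lemono (k, g)) m \<noteq> 0"
  obtains h where "m = abs_lemono (k, h)" "expo g h \<noteq> 0"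
proof -
  obtain l e where m: "m = abs_lemono (l, e)"
    by (rule lemono_rep)
  obtain h where h: "(up ^^ Suc k) e = (up ^^ Suc l) h" "expo g h \<noteq> 0"
    using assms expo_upn_supp[of g "Suc l"] unfolding m log_coeff.abs_eq prod.case by blast
  then have "(up ^^ k) e = (up ^^ l) h"
    by (auto dest: up_inj)
  then show thesis
    using that h(2) by (simp add: m abs_lemono_eq)
qed

text \<open>One more logarithm turns x^b into an exponential. With such representatives, order and
  logarithm are determined by \<open>expo\<close> alone.\<close>

lemma lemono_rep2_xpow_zero:
  obtains k g h where "a = abs_lemono (k, g)" "b = abs_lemono (k, h)" "xpow g = 0" "xpow h = 0"
proof -
  obtain k g h where "a = abs_lemono (k, g)" "b = abs_lemono (k, h)"
    by (rule lemono_rep2)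
  then show thesis
    using that[of "Suc k" "up g" "up h"] abs_lemono_shift[of k _ 1] by simp
qed

lemma log_coeff_add: "log_coeff (a + b) m = log_coeff a m + log_coeff b m"
proof -
  obtain k g h e where "a = abs_lemono (k, g)" "b = abs_lemono (k, h)" "m = abs_lemono (k, e)"
    by (rule lemono_rep3)
  then show ?thesis
    by (simp add: at_add log_coeff_same_depth expo_add)
qed

lemma log_coeff_pos:
  assumes "log_coeff a m \<noteq> 0"
  shows "0 < m"
proof -
  obtain k g where a: "a = abs_lemono (k, g)" "xpow g = 0"
    using lemono_rep2_xpow_zero[of a a] by blast
  then obtain h where h: "m = abs_lemono (k, h)" "expo g h \<noteq> 0"
    using log_coeff_supp assms by blast
  then show ?thesis
    using expo_supp_pos by (simp add: at_zero[of k] at_less)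
qed

lemma log_coeff_mono:
  assumes "a < b"
  shows "series_less (<) (log_coeff a) (log_coeff b)"
proof -
  obtain k g h where r: "a = abs_lemono (k, g)" "b = abs_lemono (k, h)" "xpow g = 0" "xpow h = 0"
    by (rule lemono_rep2_xpow_zero)
  have "series_less (<) (expo g) (expo h)"
    using assms r by (simp add: at_less emono_less_iff)
  then obtain m where m: "expo g m < expo h m" "\<And>m'. expo g m' \<noteq> expo h m' \<Longrightarrow> m' = m \<or> m' < m"
    unfolding series_less_def by blast
  have "y = abs_lemono (k, m) \<or> y < abs_lemono (k, m)" if "log_coeff a y \<noteq> log_coeff b y" for y
  proof -
    have "log_coeff a y \<noteq> 0 \<or> log_coeff b y \<noteq> 0"
      using that by auto
    then obtain m' where "y = abs_lemono (k, m')"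
      using log_coeff_supp r by blast
    then show ?thesis
      using m(2)[of m'] that r by (auto simp: log_coeff_same_depth at_less)
  qed
  then show ?thesis
    using m(1) r unfolding series_less_def by (metis log_coeff_same_depth)
qed

lemma log_coeff_hahn: "\<exists>k n. log_coeff a \<in> hahn (<) (lemonos k n)"
proof -
  obtain k g where a: "a = abs_lemono (k, g)" "xpow g = 0"
    using lemono_rep2_xpow_zero[of a a] by blast
  obtain n where "g \<in> emonos (Suc n)"
    by (rule emono_level)
  then have H: "supp (expo g) \<subseteq> emonos n" "rwo (<) (supp (expo g))"
    using expo_hahn by (auto simp: hahn_def)
  have sub: "supp (log_coeff a) \<subseteq> (\<lambda>h. abs_lemono (k, h)) ` supp (expo g)"
    using log_coeff_supp[OF a(2)] by (fastforce simp: a(1) supp_def)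
  have "rwo (<) ((\<lambda>h. abs_lemono (k, h)) ` supp (expo g))"
    by (rule rwo_image[OF H(2)]) (simp add: at_less)
  then have "rwo (<) (supp (log_coeff a))"
    using sub by (rule rwo_subset)
  moreover have "supp (log_coeff a) \<subseteq> lemonos k n"
    using sub H(1) by (auto simp: lemonos_def)
  ultimately show ?thesis
    by (auto simp: hahn_def)
qed

text \<open>The preimage is exp(f): all monomials of \<open>f\<close> have representatives of
  logarithmic depth \<open>k\<close>, so \<open>f\<close> is an exponent at that depth. The power of
  x is taken to be 0, so that it contributes nothing to the logarithm.\<close>

lemma log_coeff_surj:
  assumes f: "f \<in> hahn (<) (lemonos k n)" and pos: "\<And>m. f m \<noteq> 0 \<Longrightarrow> 0 < m"
  shows "\<exists>a. log_coeff a = f"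
proof -
  define F where "F h = f (abs_lemono (k, h))" for h
  have "supp F \<subseteq> emonos n"
    using f by (auto simp: hahn_def supp_def F_def lemonos_def at_eq)
  moreover have "rwo (<) (supp F)"
    unfolding rwo_def
  proof (intro allI impI)
    fix A assume A: "A \<subseteq> supp F" "A \<noteq> {}"
    have "rwo (<) (supp f)" "(\<lambda>h. abs_lemono (k, h)) ` A \<subseteq> supp f"
      using f A(1) by (auto simp: hahn_def supp_def F_def)
    then obtain m where "m \<in> A" "\<forall>h\<in>A. abs_lemono (k, h) = abs_lemono (k, m) \<or> abs_lemono (k, h) < abs_lemono (k, m)"
      using rwoE[of "(<)" "supp f" "(\<lambda>h. abs_lemono (k, h)) ` A"] A(2) by auto
    then show "\<exists>m\<in>A. \<forall>h\<in>A. h = m \<or> h < m"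
      unfolding at_eq at_less by blast
  qed
  ultimately have "F \<in> hahn (<) (emonos n)"
    by (simp add: hahn_def)
  moreover have "0 < h" if "F h \<noteq> 0" for h
    using pos[of "abs_lemono (k, h)"] that by (simp add: F_def at_zero[of k] at_less)
  ultimately obtain g where g: "xpow g = 0" "expo g = F"
    using expo_surj[of F n 0] by blast
  have "log_coeff (abs_lemono (k, g)) m = f m" for m
  proof (cases "\<exists>h. m = abs_lemono (k, h)")
    case True
    then show ?thesis
      by (auto simp: log_coeff_same_depth g(2) F_def)
  next
    case False
    moreover from False have "f m = 0"
      using f by (auto simp: hahn_def supp_def lemonos_def)
    ultimately show ?thesis
      using log_coeff_supp[OF g(1), of k m] by force
  qed
  then show ?thesis
    by blast
qed

section \<open>The substitution automorphisms\<close>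

text \<open>\<open>shift\<close> is the substitution \<open>x \<mapsto> exp x\<close> and \<open>unshift\<close> the substitution \<open>x \<mapsto> log x\<close>.\<close>

lift_definition shift :: "lemono \<Rightarrow> lemono" is "\<lambda>(k, g). (k, up g)"
  by (auto simp: same_lemono_def funpow_swap1[symmetric])

lift_definition unshift :: "lemono \<Rightarrow> lemono" is "\<lambda>(k, g). (Suc k, g)"
  by (auto simp: same_lemono_def)

lemma shift_abs: "shift (abs_lemono (k, g)) = abs_lemono (k, up g)"
  by (simp add: shift.abs_eq)

lemma unshift_abs: "unshift (abs_lemono (k, g)) = abs_lemono (Suc k, g)"
  by (simp add: unshift.abs_eq)

lemma shift_unshift [simp]: "shift (unshift a) = a" "unshift (shift a) = a"
proof -
  obtain k g where "a = abs_lemono (k, g)"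
    by (rule lemono_rep)
  moreover have "abs_lemono (Suc k, up g) = abs_lemono (k, g)"
    using abs_lemono_shift[of k g 1] by simp
  ultimately show "shift (unshift a) = a" "unshift (shift a) = a"
    by (simp_all add: shift_abs unshift_abs)
qed

lemma shift_add: "shift (a + b) = shift a + shift b"
  by (rule lemono_rep2[of a b]) (simp add: at_add shift_abs up_add)

lemma shift_less: "shift a < shift b \<longleftrightarrow> a < b"
  by (rule lemono_rep2[of a b]) (use upn_less[of 1] in \<open>simp add: at_less shift_abs\<close>)

lemma unshift_add: "unshift (a + b) = unshift a + unshift b"
  by (rule lemono_rep2[of a b]) (simp add: at_add unshift_abs)

lemma unshift_less: "unshift a < unshift b \<longleftrightarrow> a < b"
  by (rule lemono_rep2[of a b]) (simp add: at_less unshift_abs)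

lemma shiftn_add: "(shift ^^ k) (a + b) = (shift ^^ k) a + (shift ^^ k) b"
  by (induction k) (simp_all add: shift_add)

lemma unshiftn_add: "(unshift ^^ k) (a + b) = (unshift ^^ k) a + (unshift ^^ k) b"
  by (induction k) (simp_all add: unshift_add)

lemma unshiftn_diff: "(unshift ^^ k) (a - b) = (unshift ^^ k) a - (unshift ^^ k) b"
  using unshiftn_add[of k "a - b" b] by simp

lemma strict_mono_shiftn: "strict_mono (shift ^^ k)"
  by (induction k) (auto simp: strict_mono_def shift_less)

lemma strict_mono_unshiftn: "strict_mono (unshift ^^ k)"
  by (induction k) (auto simp: strict_mono_def unshift_less)

lemma shiftn_unshiftn: "(shift ^^ k) ((unshift ^^ k) a) = a"
  by (induction k arbitrary: a) (simp_all add: funpow_swap1)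

lemma unshiftn_shiftn: "(unshift ^^ k) ((shift ^^ k) a) = a"
  by (induction k arbitrary: a) (simp_all add: funpow_swap1)

section \<open>Sets of bounded exponential and logarithmic depth\<close>

definition level_bounded :: "lemono set \<Rightarrow> bool" where
  "level_bounded S \<longleftrightarrow> (\<exists>k n. S \<subseteq> lemonos k n)"

lemma level_bounded_subset: "level_bounded T \<Longrightarrow> S \<subseteq> T \<Longrightarrow> level_bounded S"
  unfolding level_bounded_def by blast

lemma level_bounded_Un: "level_bounded S \<Longrightarrow> level_bounded T \<Longrightarrow> level_bounded (S \<union> T)"
  unfolding level_bounded_def using LG_directed by (meson Un_least le_sup_iff order_trans)

lemma level_bounded_UN_atMost: "(\<And>i. i \<le> (N :: nat) \<Longrightarrow> level_bounded (S i)) \<Longrightarrow> level_bounded (\<Union>i\<le>N. S i)"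
  by (induction N) (auto simp: atMost_Suc intro: level_bounded_Un)

lemma level_bounded_singleton: "level_bounded {a}"
proof -
  obtain k g where a: "a = abs_lemono (k, g)"
    by (rule lemono_rep)
  obtain n where "g \<in> emonos (Suc n)"
    by (rule emono_level)
  then show ?thesis
    unfolding level_bounded_def lemonos_def using a by blast
qed

lemma level_bounded_translate:
  assumes "level_bounded S"
  shows "level_bounded ((+) a ` S)"
proof -
  have "level_bounded ({a} \<union> S)"
    using assms by (intro level_bounded_Un level_bounded_singleton)
  then obtain k n where "{a} \<union> S \<subseteq> lemonos k n"
    unfolding level_bounded_def by blast
  then have "(+) a ` S \<subseteq> lemonos k n"
    using LG_add by blast
  then show ?thesis
    unfolding level_bounded_def by blast
qed

lemma level_bounded_shiftn:
  assumes "level_bounded S"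
  shows "level_bounded ((shift ^^ j) ` S)"
proof (induction j)
  case (Suc j)
  then obtain k n where *: "(shift ^^ j) ` S \<subseteq> lemonos k n"
    unfolding level_bounded_def by blast
  have "(shift ^^ Suc j) ` S \<subseteq> lemonos k (Suc n)"
  proof
    fix a assume "a \<in> (shift ^^ Suc j) ` S"
    then obtain b where "b \<in> lemonos k n" "a = shift b"
      using * by auto
    then show "a \<in> lemonos k (Suc n)"
      using up_G by (auto simp: lemonos_def shift_abs)
  qed
  then show ?case
    unfolding level_bounded_def by blast
qed (use assms in simp)

lemma level_bounded_unshiftn:
  assumes "level_bounded S"
  shows "level_bounded ((unshift ^^ j) ` S)"
proof (induction j)
  case (Suc j)
  then obtain k n where *: "(unshift ^^ j) ` S \<subseteq> lemonos k n"
    unfolding level_bounded_def by blast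
  have "(unshift ^^ Suc j) ` S \<subseteq> lemonos (Suc k) n"
  proof
    fix a assume "a \<in> (unshift ^^ Suc j) ` S"
    then obtain b where "b \<in> lemonos k n" "a = unshift b"
      using * by auto
    then show "a \<in> lemonos (Suc k) n"
      by (auto simp: lemonos_def unshift_abs)
  qed
  then show ?case
    unfolding level_bounded_def by blast
qed (use assms in simp)

section \<open>Gluing isomorphisms of intervals\<close>

text \<open>\<open>stair a b \<tau>\<close> maps the interval from \<open>a (Suc n)\<close> to \<open>a n\<close> to the one from \<open>b (Suc n)\<close> to \<open>b n\<close> by
  \<open>\<tau> (Suc n)\<close>, after moving the left end points to \<open>0\<close>. Elements below all \<open>a n\<close> get junk values.\<close>

definition stair_index :: "(nat \<Rightarrow> 'a::linorder) \<Rightarrow> 'a \<Rightarrow> nat" where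
  "stair_index a y = (LEAST n. a n \<le> y)"

definition stair :: "(nat \<Rightarrow> 'a::linordered_ab_group_add) \<Rightarrow> (nat \<Rightarrow> 'b::ab_group_add) \<Rightarrow> (nat \<Rightarrow> 'a \<Rightarrow> 'b) \<Rightarrow> 'a \<Rightarrow> 'b"
  where "stair a b \<tau> y = b (stair_index a y) + \<tau> (stair_index a y) (y - a (stair_index a y))"

text \<open>By \<open>step\<close> right end points correspond to right end points, so consecutive
  pieces fit together. Bijectivity will come from a second staircase with \<open>a\<close> and
  \<open>b\<close> exchanged and inverse pieces.\<close>

locale staircase =
  fixes a :: "nat \<Rightarrow> 'a::linordered_ab_group_add"
    and b :: "nat \<Rightarrow> 'b::linordered_ab_group_add"
    and \<tau> :: "nat \<Rightarrow> 'a \<Rightarrow> 'b"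
  assumes decseq: "decseq b"
    and strict_mono: "strict_mono (\<tau> n)"
    and zero: "\<tau> n 0 = 0"
    and step: "\<tau> (Suc n) (a n - a (Suc n)) = b n - b (Suc n)"
begin

lemma index_le:
  assumes "a n \<le> y"
  shows "a (stair_index a y) \<le> y"
  unfolding stair_index_def using assms by (rule LeastI)

lemma stair_ge:
  assumes "a n \<le> y"
  shows "b (stair_index a y) \<le> stair a b \<tau> y"
proof -
  have "\<tau> (stair_index a y) 0 \<le> \<tau> (stair_index a y) (y - a (stair_index a y))"
    using index_le[OF assms] by (simp add: strict_mono_less_eq[OF strict_mono])
  then show ?thesis
    by (simp add: stair_def zero)
qed

lemma stair_less:
  assumes "stair_index a y = Suc m"
  shows "stair a b \<tau> y < b m"
proof -
  have "y < a m"
    using not_less_Least[of m "\<lambda>n. a n \<le> y"] assms by (simp add: stair_index_def)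
  then have "\<tau> (Suc m) (y - a (Suc m)) < \<tau> (Suc m) (a m - a (Suc m))"
    by (simp add: strict_mono_less[OF strict_mono])
  then show ?thesis
    unfolding stair_def assms step by (simp add: algebra_simps)
qed

lemma stair_less_earlier:
  assumes "i < stair_index a y"
  shows "stair a b \<tau> y < b i"
proof -
  obtain m where m: "stair_index a y = Suc m"
    using assms by (cases "stair_index a y") auto
  then show ?thesis
    using stair_less[OF m] decseqD[OF decseq, of i m] assms by auto
qed

text \<open>The image stays in the interval of the same index, so the staircase in the opposite
  direction selects the matching piece and can undo it.\<close>

lemma stair_index_stair:
  assumes "a n \<le> y"
  shows "stair_index b (stair a b \<tau> y) = stair_index a y"
  unfolding stair_index_def[of b]
proof (rule Least_equality)
  show "b (stair_index a y) \<le> stair a b \<tau> y"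
    by (rule stair_ge[OF assms])
  show "stair_index a y \<le> i" if "b i \<le> stair a b \<tau> y" for i
    using stair_less_earlier[of i y] that by (auto simp: not_less[symmetric])
qed

lemma stair_stair:
  assumes "a n \<le> y" "\<And>n z. \<tau>' n (\<tau> n z) = z"
  shows "stair b a \<tau>' (stair a b \<tau> y) = y"
  unfolding stair_def[of b] stair_index_stair[OF assms(1)] by (simp add: stair_def assms(2))

lemma stair_strict_mono:
  assumes "a n \<le> y" "y < z"
  shows "stair a b \<tau> y < stair a b \<tau> z"
proof -
  have "stair_index a z \<le> stair_index a y"
    unfolding stair_index_def[of a z] using index_le[OF assms(1)] assms(2) by (intro Least_le) auto
  then consider "stair_index a z = stair_index a y" | "stair_index a z < stair_index a y"
    by linarith
  then show ?thesis
  proof cases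
    case 1
    then show ?thesis
      using assms(2) by (simp add: stair_def strict_mono_less[OF strict_mono])
  next
    case 2
    have "a n \<le> z"
      using assms by simp
    then show ?thesis
      using stair_less_earlier[OF 2] stair_ge[of n z] by simp
  qed
qed

end

section \<open>All monomials and the monomials above one\<close>

definition var0 :: lemono where
  "var0 = abs_lemono (0, var)"

text \<open>In the additive notation for monomials the minus sign is the reciprocal: this is 1 /
  e_n.\<close>

definition neg_stairs :: "nat \<Rightarrow> lemono" where
  "neg_stairs n = - (shift ^^ n) var0"

definition log_stairs :: "nat \<Rightarrow> lemono" where
  "log_stairs n = (unshift ^^ n) var0"

lemma shiftn_var0: "(shift ^^ n) var0 = abs_lemono (0, (up ^^ n) var)"
  by (induction n) (simp_all add: var0_def shift_abs)

lemma log_stairs_abs: "log_stairs n = abs_lemono (n, var)"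
  unfolding log_stairs_def by (induction n) (simp_all add: var0_def unshift_abs)

lemma log_stairs_pos: "0 < log_stairs n"
  by (simp add: log_stairs_abs at_zero[of n] at_less var_pos)

text \<open>Here g(log_k x) = (\<open>up g\<close>)(log_(k+1) x), and \<open>up g\<close> exceeds
  \<open>var\<close>. The bound depends on the logarithmic depth only.\<close>

lemma log_stairs_coinitial:
  assumes "0 < abs_lemono (k, g)"
  shows "log_stairs (Suc k) < abs_lemono (k, g)"
proof -
  have "var < up g"
    using assms by (intro var_less_up) (simp add: at_zero[of k] at_less)
  then show ?thesis
    using abs_lemono_shift[of k g 1] by (simp add: log_stairs_abs at_less)
qed

lemma log_stairs_decseq: "decseq log_stairs"
proof (rule decseq_SucI)
  fix n show "log_stairs (Suc n) \<le> log_stairs n"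
    using log_stairs_coinitial[of n var] log_stairs_pos[of n] by (simp add: log_stairs_abs[of n])
qed

lemma neg_stairs_decseq: "decseq neg_stairs"
proof (rule decseq_SucI)
  fix n
  have "var < up var"
    by (rule var_less_up[OF var_pos])
  then have "(up ^^ n) var < (up ^^ Suc n) var"
    by (simp only: funpow_Suc_right o_apply upn_less)
  then show "neg_stairs (Suc n) \<le> neg_stairs n"
    by (simp add: neg_stairs_def shiftn_var0 less_imp_le at_less del: funpow.simps)
qed

text \<open>The reciprocal of \<open>a\<close> lies below e_(n+1) evaluated at l_k, and l_k is at
  most x. The bound depends on the exponential depth only.\<close>

lemma lemonos_ge_neg_stairs:
  assumes "a \<in> lemonos k n"
  shows "neg_stairs (Suc n) \<le> a"
proof -
  obtain g where g: "g \<in> emonos n" "a = abs_lemono (k, g)"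
    using assms by (auto simp: lemonos_def)
  have "- g < (up ^^ Suc n) var"
    using g(1) by (intro emonos_less_upn_var emonos_uminus)
  then have "- a < abs_lemono (k, (up ^^ Suc n) var)"
    by (simp only: g(2) at_uminus at_less)
  also have "\<dots> = (shift ^^ Suc n) (log_stairs k)"
  proof -
    have "(shift ^^ j) (abs_lemono (k, h)) = abs_lemono (k, (up ^^ j) h)" for j h
      by (induction j) (simp_all add: shift_abs)
    then show ?thesis
      by (simp only: log_stairs_abs)
  qed
  also have "\<dots> \<le> (shift ^^ Suc n) var0"
    using decseqD[OF log_stairs_decseq, of 0 k]
    by (simp add: strict_mono_less_eq[OF strict_mono_shiftn] log_stairs_def del: funpow.simps)
  finally show ?thesis
    unfolding neg_stairs_def by (simp add: minus_less_iff less_imp_le del: funpow.simps)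
qed

text \<open>For \<open>n = 0\<close> the truncated difference \<open>2 * n - 1\<close> is \<open>0\<close>, as it should be: the topmost piece is
  only translated.\<close>

definition to_pos :: "lemono \<Rightarrow> lemono" where
  "to_pos = stair neg_stairs log_stairs (\<lambda>n. unshift ^^ (2 * n - 1))"

definition from_pos :: "lemono \<Rightarrow> lemono" where
  "from_pos = stair log_stairs neg_stairs (\<lambda>n. shift ^^ (2 * n - 1))"

text \<open>Of the 2n+1 logarithms, n+1 cancel e_(n+1) down to x and n remain, giving l_n; likewise
  n cancel e_n and n+1 remain, giving l_(n+1).\<close>

lemma stairs_step:
  "(unshift ^^ (2 * Suc n - 1)) (neg_stairs n - neg_stairs (Suc n)) = log_stairs n - log_stairs (Suc n)"
proof -
  have "neg_stairs n - neg_stairs (Suc n) = (shift ^^ Suc n) var0 - (shift ^^ n) var0"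
    by (simp add: neg_stairs_def)
  moreover have "(unshift ^^ (2 * Suc n - 1)) ((shift ^^ Suc n) var0) = log_stairs n"
  proof -
    have "2 * Suc n - 1 = n + Suc n" by simp
    then show ?thesis
      by (simp only: funpow_add o_apply unshiftn_shiftn log_stairs_def)
  qed
  moreover have "(unshift ^^ (2 * Suc n - 1)) ((shift ^^ n) var0) = log_stairs (Suc n)"
  proof -
    have "2 * Suc n - 1 = Suc n + n" by simp
    then show ?thesis
      by (simp only: funpow_add o_apply unshiftn_shiftn log_stairs_def)
  qed
  ultimately show ?thesis
    by (simp only: unshiftn_diff)
qed

interpretation lower: staircase neg_stairs log_stairs "\<lambda>n. unshift ^^ (2 * n - 1)"
proof
  show "(unshift ^^ (2 * n - 1)) 0 = 0" for n
    using unshiftn_add[of "2 * n - 1" 0 0] by simp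
qed (rule log_stairs_decseq strict_mono_unshiftn stairs_step)+

interpretation raise: staircase log_stairs neg_stairs "\<lambda>n. shift ^^ (2 * n - 1)"
proof
  show "(shift ^^ (2 * n - 1)) 0 = 0" for n
    using shiftn_add[of "2 * n - 1" 0 0] by simp
  show "(shift ^^ (2 * Suc n - 1)) (log_stairs n - log_stairs (Suc n)) = neg_stairs n - neg_stairs (Suc n)" for n
    by (simp only: stairs_step[symmetric] shiftn_unshiftn)
qed (rule neg_stairs_decseq strict_mono_shiftn)+

lemma neg_stairs_coinitial: "\<exists>n. neg_stairs n \<le> a"
  using level_bounded_singleton[of a] lemonos_ge_neg_stairs unfolding level_bounded_def by blast

lemma log_stairs_coinitial_pos: "0 < a \<Longrightarrow> \<exists>n. log_stairs n \<le> a"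
  by (rule lemono_rep[of a]) (use log_stairs_coinitial less_imp_le in blast)

lemma to_pos_strict_mono: "a < b \<Longrightarrow> to_pos a < to_pos b"
  unfolding to_pos_def
  using neg_stairs_coinitial lower.stair_strict_mono by blast

lemma to_pos_pos: "0 < to_pos a"
  unfolding to_pos_def
  using neg_stairs_coinitial[of a] lower.stair_ge log_stairs_pos by (meson less_le_trans)

lemma from_pos_to_pos: "from_pos (to_pos a) = a"
  unfolding to_pos_def from_pos_def
  using neg_stairs_coinitial[of a] lower.stair_stair[of _ a "\<lambda>n. shift ^^ (2 * n - 1)"] shiftn_unshiftn by blast

lemma to_pos_from_pos: "0 < a \<Longrightarrow> to_pos (from_pos a) = a"
  unfolding to_pos_def from_pos_def
  using log_stairs_coinitial_pos[of a] raise.stair_stair[of _ a "\<lambda>n. unshift ^^ (2 * n - 1)"] unshiftn_shiftn by blast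

lemma to_pos_less_iff: "to_pos a < to_pos b \<longleftrightarrow> a < b"
  using to_pos_strict_mono by (metis less_asym linorder_neqE)

text \<open>The lower bound \<open>a N\<close> limits the indices to at most \<open>N\<close>. Each
  piece is a composition of two translations and some \<open>\<tau> i\<close>, which preserve
  bounded depth; for simplicity each is applied to all of \<open>S\<close>.\<close>

lemma level_bounded_stair:
  assumes \<tau>: "\<And>n T. level_bounded T \<Longrightarrow> level_bounded (\<tau> n ` T)" and S: "level_bounded S"
    and N: "\<And>y. y \<in> S \<Longrightarrow> a N \<le> y"
  shows "level_bounded (stair a b \<tau> ` S)"
proof (rule level_bounded_subset)
  have "level_bounded ((+) (b i) ` \<tau> i ` (+) (- a i) ` S)" for i
    by (intro level_bounded_translate \<tau> S)
  then show "level_bounded (\<Union>i\<le>N. (+) (b i) ` \<tau> i ` (+) (- a i) ` S)"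
    by (intro level_bounded_UN_atMost)
  show "stair a b \<tau> ` S \<subseteq> (\<Union>i\<le>N. (+) (b i) ` \<tau> i ` (+) (- a i) ` S)"
  proof
    fix z assume "z \<in> stair a b \<tau> ` S"
    then obtain y where y: "y \<in> S" "z = stair a b \<tau> y"
      by blast
    have "stair_index a y \<le> N"
      unfolding stair_index_def using N[OF y(1)] by (rule Least_le)
    moreover have "z = b (stair_index a y) + \<tau> (stair_index a y) (- a (stair_index a y) + y)"
      by (simp add: y(2) stair_def)
    ultimately show "z \<in> (\<Union>i\<le>N. (+) (b i) ` \<tau> i ` (+) (- a i) ` S)"
      using y(1) by blast
  qed
qed

lemma level_bounded_to_pos:
  assumes "level_bounded S"
  shows "level_bounded (to_pos ` S)"
proof -
  obtain k n where S: "S \<subseteq> lemonos k n"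
    using assms unfolding level_bounded_def by blast
  show ?thesis
    unfolding to_pos_def
  proof (rule level_bounded_stair[OF level_bounded_unshiftn assms])
    show "neg_stairs (Suc n) \<le> y" if "y \<in> S" for y
      using S that by (blast intro: lemonos_ge_neg_stairs)
  qed
qed

lemma level_bounded_from_pos:
  assumes "level_bounded S" and pos: "\<And>a. a \<in> S \<Longrightarrow> 0 < a"
  shows "level_bounded (from_pos ` S)"
proof -
  obtain k n where S: "S \<subseteq> lemonos k n"
    using assms(1) unfolding level_bounded_def by blast
  show ?thesis
    unfolding from_pos_def
  proof (rule level_bounded_stair[OF level_bounded_shiftn assms(1)])
    fix y assume y: "y \<in> S"
    obtain g where "y = abs_lemono (k, g)"
      using S y by (auto simp: lemonos_def)
    then show "log_stairs (Suc k) \<le> y"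
      using log_stairs_coinitial pos[OF y] by (simp add: less_imp_le)
  qed
qed

section \<open>The isomorphism\<close>

lemma hahn_level_bounded_iff: "(\<exists>k n. f \<in> hahn (<) (lemonos k n)) \<longleftrightarrow> rwo (<) (supp f) \<and> level_bounded (supp f)"
  by (auto simp: hahn_def level_bounded_def)

lemma log_coeff_to_pos_hahn: "\<exists>k n. (\<lambda>m. log_coeff a (to_pos m)) \<in> hahn (<) (lemonos k n)"
proof -
  have L: "rwo (<) (supp (log_coeff a))" "level_bounded (supp (log_coeff a))"
    using log_coeff_hahn[of a] by (simp_all add: hahn_level_bounded_iff)
  have pos: "0 < m" if "m \<in> supp (log_coeff a)" for m
    using that log_coeff_pos by (simp add: supp_def)
  have sub: "supp (\<lambda>m. log_coeff a (to_pos m)) \<subseteq> from_pos ` supp (log_coeff a)"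
  proof
    fix m assume "m \<in> supp (\<lambda>m. log_coeff a (to_pos m))"
    then show "m \<in> from_pos ` supp (log_coeff a)"
      by (intro image_eqI[of _ _ "to_pos m"]) (simp_all add: supp_def from_pos_to_pos)
  qed
  have "rwo (<) (from_pos ` supp (log_coeff a))"
  proof (rule rwo_image[OF L(1)])
    fix m m' assume "m \<in> supp (log_coeff a)" "m' \<in> supp (log_coeff a)" "m < m'"
    then show "from_pos m = from_pos m' \<or> from_pos m < from_pos m'"
      using to_pos_less_iff[of "from_pos m" "from_pos m'"] by (simp add: to_pos_from_pos pos)
  qed
  then show ?thesis
    unfolding hahn_level_bounded_iff
    using rwo_subset[OF _ sub] level_bounded_subset[OF level_bounded_from_pos[OF L(2) pos] sub] by simp
qed

text \<open>Relabelling acts on coefficient functions by composition with \<open>to_pos\<close>: a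
  term r * m of log a becomes r * \<open>from_pos m\<close>.\<close>

definition log_iso :: "lemono \<Rightarrow> transseries" where
  "log_iso a = Abs_transseries (\<lambda>m. log_coeff a (to_pos m))"

lemma coeff_log_iso: "coeff (log_iso a) m = log_coeff a (to_pos m)"
  unfolding log_iso_def using log_coeff_to_pos_hahn[of a] by (simp add: Abs_transseries_inverse)

lemma log_iso_add: "log_iso (a + b) = log_iso a + log_iso b"
  by (simp add: coeff_inject[symmetric] fun_eq_iff plus_transseries.rep_eq coeff_log_iso log_coeff_add)

lemma log_iso_strict_mono:
  assumes "a < b"
  shows "log_iso a < log_iso b"
proof -
  obtain m where m: "log_coeff a m < log_coeff b m"
    "\<And>m'. log_coeff a m' \<noteq> log_coeff b m' \<Longrightarrow> m' = m \<or> m' < m"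
    using log_coeff_mono[OF assms] unfolding series_less_def by blast
  have "log_coeff a m \<noteq> 0 \<or> log_coeff b m \<noteq> 0"
    using m(1) by auto
  \<comment> \<open>The top difference is at a monomial > 1, so it is in the range of
    \<open>to_pos\<close> and survives the relabelling.\<close>
  then have "0 < m"
    using log_coeff_pos by blast
  then have to_m: "to_pos (from_pos m) = m"
    by (rule to_pos_from_pos)
  have "m' = from_pos m \<or> m' < from_pos m" if "log_coeff a (to_pos m') \<noteq> log_coeff b (to_pos m')" for m'
    using m(2)[OF that] from_pos_to_pos[of m'] to_pos_less_iff[of m' "from_pos m"] to_m by auto
  then show ?thesis
    unfolding less_transseries.rep_eq series_less_def coeff_log_iso
    using m(1) to_m by (intro exI[of _ "from_pos m"]) auto
qed

lemma log_iso_less_iff: "log_iso a < log_iso b \<longleftrightarrow> a < b"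
  using log_iso_strict_mono by (metis less_asym linorder_neqE)

lemma log_iso_surj: "surj log_iso"
proof -
  have "\<exists>a. log_iso a = t" for t
  proof -
    \<comment> \<open>The relabelling is undone: \<open>f\<close> is purely infinite, hence the
      logarithm of some monomial.\<close>
    define f where "f m = (if 0 < m then coeff t (from_pos m) else 0)" for m
    have t: "rwo (<) (supp (coeff t))" "level_bounded (supp (coeff t))"
      using coeff[of t] by (simp_all add: hahn_level_bounded_iff)
    have sub: "supp f \<subseteq> to_pos ` supp (coeff t)"
    proof
      fix m assume "m \<in> supp f"
      then show "m \<in> to_pos ` supp (coeff t)"
        using to_pos_from_pos[of m] by (intro image_eqI[of _ _ "from_pos m"]) (auto simp: supp_def f_def split: if_splits)
    qed
    have "rwo (<) (to_pos ` supp (coeff t))"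
      by (rule rwo_image[OF t(1)]) (simp add: to_pos_less_iff)
    then have "\<exists>k n. f \<in> hahn (<) (lemonos k n)"
      unfolding hahn_level_bounded_iff using rwo_subset[OF _ sub] level_bounded_subset[OF level_bounded_to_pos[OF t(2)] sub] by simp
    moreover have "0 < m" if "f m \<noteq> 0" for m
      using that unfolding f_def by presburger
    ultimately obtain a where "log_coeff a = f"
      using log_coeff_surj by blast
    then have "log_iso a = t"
      by (simp add: coeff_inject[symmetric] fun_eq_iff coeff_log_iso f_def to_pos_pos from_pos_to_pos)
    then show ?thesis
      by blast
  qed
  then show ?thesis
    unfolding surj_def by metis
qed

lemma inj_monomial: "inj monomial"
  by (rule injI) (metis monomial_less less_irrefl linorder_neqE)

theorem theorem8p7:
  shows "\<exists>\<phi> :: transseries \<Rightarrow> transseries.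
    bij_betw \<phi> transmonomials UNIV \<and>
    (\<forall>m\<in>transmonomials. \<forall>n\<in>transmonomials. \<phi> (m * n) = \<phi> m + \<phi> n) \<and>
    (\<forall>m\<in>transmonomials. \<forall>n\<in>transmonomials. m < n \<longleftrightarrow> \<phi> m < \<phi> n)"
proof -
  \<comment> \<open>On a transmonomial \<open>inv monomial\<close> returns the underlying
    LE-monomial; elsewhere its value is arbitrary.\<close>
  define \<phi> where "\<phi> = log_iso \<circ> inv monomial"
  have \<phi>: "\<phi> (monomial a) = log_iso a" for a
    by (simp add: \<phi>_def inv_f_f[OF inj_monomial])
  have "inj log_iso"
    by (rule injI) (metis log_iso_less_iff less_irrefl linorder_neqE)
  then have "inj_on \<phi> transmonomials"
    by (auto simp: inj_on_def transmonomials_def \<phi>)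
  moreover have "\<phi> ` transmonomials = UNIV"
    using log_iso_surj by (simp add: transmonomials_def image_image \<phi>)
  ultimately have "bij_betw \<phi> transmonomials UNIV"
    by (simp add: bij_betw_def)
  moreover have "\<forall>m\<in>transmonomials. \<forall>n\<in>transmonomials. \<phi> (m * n) = \<phi> m + \<phi> n"
    by (auto simp: transmonomials_def monomial_add[symmetric] \<phi> log_iso_add)
  moreover have "\<forall>m\<in>transmonomials. \<forall>n\<in>transmonomials. m < n \<longleftrightarrow> \<phi> m < \<phi> n"
    by (auto simp: transmonomials_def monomial_less \<phi> log_iso_less_iff)
  ultimately show ?thesis
    by blast
qed

end
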